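(* Let $n\ge 2$ and let $S\subseteq[0,1]^n$ be an $n$-cube antichain which is a smooth hypersurface. For $j=1,\ldots,n$ let $\pi_j:[0,1]^n\to[0,1]^n$ be $\pi_j(x_1,\ldots,x_n)=(x_1,\ldots,x_{j-1},0,x_{j+1},\ldots,x_n)$. Then \[\mathcal{H}^{n-1}(S)\le\sum_{j=1}^n\mathcal{H}^{n-1}(\pi_j(S)).\] In particular, $\mathcal{H}^{n-1}(S)\le n\,\sigma_{n-1}$, where $\sigma_{n-1}=\frac{2^{n-1}\Gamma((n-1)/2+1)}{\pi^{(n-1)/2}}$.
   Context: A subset $S$ of $[0,1]^n$ is an $n$-cube antichain if it does not contain two (distinct) elements $\mathbf{x},\mathbf{y}$ with $x_i\le y_i$ for all $i$. For $S\subseteq\mathbb{R}^n$ and $s>0$, $\mathcal{H}^s(S)=\lim_{\delta\to0}\inf\{\sum_i \operatorname{diam}(U_i)^s : S\subseteq\bigcup_i U_i,\ \operatorname{diam}(U_i)\le\delta\}$ is the unnormalized $s$-dimensional Hausdorff measure; with this normalization $\sigma_{n-1}$ equals the $(n-1)$-dimensional Hausdorff measure of a unit $(n-1)$-cube. *)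

theory Defs
  imports "HOL-Analysis.Analysis"
begin

definition unit_cube :: "(real ^ 'n) set" where
  "unit_cube = {x. \<forall>i. 0 \<le> x $ i \<and> x $ i \<le> 1}"

definition cube_antichain :: "(real ^ 'n) set \<Rightarrow> bool" where
  "cube_antichain S \<longleftrightarrow> S \<subseteq> unit_cube \<and>
     \<not> (\<exists>x\<in>S. \<exists>y\<in>S. x \<noteq> y \<and> (\<forall>i. x $ i \<le> y $ i))"

definition coord_proj :: "'n \<Rightarrow> real ^ 'n \<Rightarrow> real ^ 'n" where
  "coord_proj j x = (\<chi> i. if i = j then 0 else x $ i)"

(* The covers are sequences of sets; finite covers are included because members of the
   sequence may be empty.  Boundedness is required explicitly since diameter is only
   meaningful on bounded sets. *)
definition hausdorff_pre :: "real \<Rightarrow> real \<Rightarrow> 'a::metric_space set \<Rightarrow> ennreal" where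
  "hausdorff_pre s \<delta> S =
     Inf {(\<Sum>i. ennreal (diameter (U i) powr s)) | U :: nat \<Rightarrow> 'a set.
            S \<subseteq> (\<Union>i. U i) \<and> (\<forall>i. bounded (U i) \<and> diameter (U i) \<le> \<delta>)}"

(* Unnormalized s-dimensional Hausdorff (outer) measure, for s > 0: since 0 powr s = 0,
   sets of diameter 0 contribute nothing. *)
definition hausdorff_measure :: "real \<Rightarrow> 'a::metric_space set \<Rightarrow> ennreal" where
  "hausdorff_measure s S = Lim (at_right 0) (\<lambda>\<delta>. hausdorff_pre s \<delta> S)"

lemma hausdorff_pre_antimono:
  assumes "\<delta> \<le> \<delta>'"
  shows "hausdorff_pre s \<delta>' S \<le> hausdorff_pre s \<delta> S"
  unfolding hausdorff_pre_def
  by (rule Inf_superset_mono) (use assms in \<open>auto intro: order_trans\<close>)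

lemma tendsto_hausdorff_pre_SUP:
  "((\<lambda>\<delta>. hausdorff_pre s \<delta> S) \<longlongrightarrow> (SUP \<delta>\<in>{0<..}. hausdorff_pre s \<delta> S)) (at_right 0)"
proof (rule order_tendstoI)
  fix a assume "a < (SUP \<delta>\<in>{0<..}. hausdorff_pre s \<delta> S)"
  then obtain d :: real where "d > 0" and d: "a < hausdorff_pre s d S"
    by (auto simp: less_SUP_iff)
  have "\<forall>\<^sub>F \<delta> in at_right 0. \<delta> \<in> {0<..<d}"
    using \<open>d > 0\<close> by (rule eventually_at_right_real)
  then show "\<forall>\<^sub>F \<delta> in at_right 0. a < hausdorff_pre s \<delta> S"
  proof eventually_elim
    fix \<delta> assume "\<delta> \<in> {0<..<d}"
    then have "hausdorff_pre s d S \<le> hausdorff_pre s \<delta> S"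
      by (intro hausdorff_pre_antimono) simp
    with d show "a < hausdorff_pre s \<delta> S" by (rule less_le_trans)
  qed
next
  fix a assume a: "(SUP \<delta>\<in>{0<..}. hausdorff_pre s \<delta> S) < a"
  have "\<forall>\<^sub>F \<delta> in at_right 0. \<delta> \<in> {0<..<(1::real)}"
    by (rule eventually_at_right_real) simp
  then show "\<forall>\<^sub>F \<delta> in at_right 0. hausdorff_pre s \<delta> S < a"
  proof eventually_elim
    fix \<delta> :: real assume "\<delta> \<in> {0<..<1}"
    then have "hausdorff_pre s \<delta> S \<le> (SUP \<delta>\<in>{0<..}. hausdorff_pre s \<delta> S)"
      by (intro SUP_upper) simp
    then show "hausdorff_pre s \<delta> S < a" using a by (rule le_less_trans)
  qed
qed

lemma hausdorff_measure_eq_SUP: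
  "hausdorff_measure s S = (SUP \<delta>\<in>{0<..}. hausdorff_pre s \<delta> S)"
  unfolding hausdorff_measure_def
  by (rule tendsto_Lim[OF _ tendsto_hausdorff_pre_SUP]) simp

definition sigma_const :: "nat \<Rightarrow> real" where
  "sigma_const d = 2 ^ d * Gamma (real d / 2 + 1) / pi powr (real d / 2)"

(* Ck_on k U f: the function f is k times continuously differentiable on the open set U
   (C^0 is continuity; C^(k+1) means that a gradient field exists on U with C^k components). *)
primrec Ck_on :: "nat \<Rightarrow> (real ^ 'n) set \<Rightarrow> (real ^ 'n \<Rightarrow> real) \<Rightarrow> bool" where
  "Ck_on 0 U f \<longleftrightarrow> continuous_on U f"
| "Ck_on (Suc k) U f \<longleftrightarrow>
     (\<exists>g. (\<forall>x\<in>U. GDERIV f x :> g x) \<and> (\<forall>i. Ck_on k U (\<lambda>x. g x $ i)))"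

definition smooth_fun_on :: "(real ^ 'n) set \<Rightarrow> (real ^ 'n \<Rightarrow> real) \<Rightarrow> bool" where
  "smooth_fun_on U f \<longleftrightarrow> (\<forall>k. Ck_on k U f)"

(* Embedded C^infinity hypersurface of R^n, without boundary: locally a regular level set.
   It need not be closed, connected or bounded. *)
definition smooth_hypersurface :: "(real ^ 'n) set \<Rightarrow> bool" where
  "smooth_hypersurface S \<longleftrightarrow>
     (\<forall>p\<in>S. \<exists>U f g. open U \<and> p \<in> U \<and> smooth_fun_on U f \<and>
        (\<forall>x\<in>U. GDERIV f x :> g x) \<and> (\<forall>x\<in>S \<inter> U. g x \<noteq> 0) \<and>
        S \<inter> U = {x \<in> U. f x = 0})"

end

theory Submission
  imports Defs
begin

text \<open>
  Near each of its points, \<open>S\<close> is almost flat: projecting to the tangent hyperplane with unit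
  normal \<open>\<nu>\<close> distorts distances by a factor close to \<open>1\<close>. On that hyperplane \<open>\<pi>\<^sub>j\<close> multiplies the
  \<open>(n - 1)\<close>-dimensional measure by \<open>\<bar>\<nu>\<^sub>j\<bar>\<close>, and \<open>\<Sum>\<^sub>j \<bar>\<nu>\<^sub>j\<bar> \<ge> \<parallel>\<nu>\<parallel> = 1\<close>, so small pieces of \<open>S\<close> satisfy the
  inequality up to a factor close to \<open>1\<close>. As \<open>S\<close> is an antichain, each \<open>\<pi>\<^sub>j\<close> is injective on \<open>S\<close>; hence
  disjoint pieces of \<open>S\<close> have disjoint projections, and the local estimates add up. The isodiametric
  inequality is not needed: it suffices that on bounded measurable sets the Hausdorff measure of top
  dimension is some constant multiple of Lebesgue measure, together with the bound
  \<open>\<sigma>\<^sub>n\<^sub>-\<^sub>1\<close> for that constant, which comes from a Vitali covering of the cube by small balls.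
\<close>

section \<open>Hausdorff measures\<close>

lemma hausdorff_pre_le_suminf:
  assumes "S \<subseteq> (\<Union>i. U i)" "\<And>i. bounded (U i)" "\<And>i. diameter (U i) \<le> \<delta>"
  shows "hausdorff_pre s \<delta> S \<le> (\<Sum>i. ennreal (diameter (U i) powr s))"
  unfolding hausdorff_pre_def using assms by (intro Inf_lower) auto

lemma hausdorff_pre_close:
  assumes "hausdorff_pre s \<delta> S < x"
  shows "\<exists>U :: nat \<Rightarrow> _. S \<subseteq> (\<Union>i. U i) \<and> (\<forall>i. bounded (U i) \<and> diameter (U i) \<le> \<delta>) \<and>
    (\<Sum>i. ennreal (diameter (U i) powr s)) < x"
  using assms unfolding hausdorff_pre_def Inf_less_iff by blast

lemma hausdorff_pre_mono:
  assumes "S \<subseteq> T"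
  shows "hausdorff_pre s \<delta> S \<le> hausdorff_pre s \<delta> T"
  unfolding hausdorff_pre_def
  by (rule Inf_superset_mono) (use assms in blast)

lemma hausdorff_measure_mono:
  assumes "S \<subseteq> T"
  shows "hausdorff_measure s S \<le> hausdorff_measure s T"
  unfolding hausdorff_measure_eq_SUP
  by (intro SUP_mono) (use hausdorff_pre_mono[OF assms] in blast)

lemma hausdorff_pre_le_measure:
  assumes "\<delta> > 0"
  shows "hausdorff_pre s \<delta> S \<le> hausdorff_measure s S"
  unfolding hausdorff_measure_eq_SUP using assms by (intro SUP_upper) simp

lemma hausdorff_measure_leI:
  assumes "\<And>\<delta>. \<delta> > 0 \<Longrightarrow> hausdorff_pre s \<delta> S \<le> x"
  shows "hausdorff_measure s S \<le> x"
  unfolding hausdorff_measure_eq_SUP using assms by (intro SUP_least) simp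

text \<open>The usual argument: cover each \<open>A n\<close> within \<open>e / 2 ^ (n + 1)\<close>
  of its infimum and merge the covers into one sequence by the pairing function.\<close>

lemma hausdorff_pre_countably_subadditive:
  "hausdorff_pre s \<delta> (\<Union>i::nat. A i) \<le> (\<Sum>i. hausdorff_pre s \<delta> (A i))"
proof (rule ennreal_le_epsilon)
  fix e :: real assume "0 < e" and fin: "(\<Sum>i. hausdorff_pre s \<delta> (A i)) < top"
  \<comment> \<open>A finite sum has finite terms, so adding a positive number to a term increases
    it strictly.\<close>
  then have *: "hausdorff_pre s \<delta> (A n) < hausdorff_pre s \<delta> (A n) + e * (1/2)^Suc n" for n
    by (auto simp add: less_top dest!: ennreal_suminf_lessD)
  have "\<forall>n. \<exists>U. A n \<subseteq> (\<Union>i::nat. U i) \<and> (\<forall>i. bounded (U i) \<and> diameter (U i) \<le> \<delta>) \<and>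
     (\<Sum>i. ennreal (diameter (U i) powr s)) < hausdorff_pre s \<delta> (A n) + e * (1/2)^Suc n"
    by (intro allI hausdorff_pre_close *)
  from choice[OF this] obtain B where B: "\<forall>n. A n \<subseteq> (\<Union>i::nat. B n i) \<and>
     (\<forall>i. bounded (B n i) \<and> diameter (B n i) \<le> \<delta>) \<and>
     (\<Sum>i. ennreal (diameter (B n i) powr s)) < hausdorff_pre s \<delta> (A n) + e * (1/2)^Suc n"
    ..
  define C where "C = case_prod B o prod_decode"
  have "(\<Union>i. A i) \<subseteq> (\<Union>i. C i)"
  proof safe
    fix x n assume "x \<in> A n"
    then obtain i where "x \<in> B n i" using B by blast
    then have "x \<in> C (prod_encode (n, i))" by (simp add: C_def)
    then show "x \<in> (\<Union>i. C i)" by blast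
  qed
  then have "hausdorff_pre s \<delta> (\<Union>i. A i) \<le> (\<Sum>i. ennreal (diameter (C i) powr s))"
    by (rule hausdorff_pre_le_suminf) (use B in \<open>simp_all add: C_def split: prod.split\<close>)
  also have "\<dots> = (\<Sum>n. \<Sum>i. ennreal (diameter (B n i) powr s))"
    unfolding C_def comp_def
    by (rule suminf_ennreal_2dimen[where f = "\<lambda>x. ennreal (diameter (case_prod B x) powr s)"]) simp
  also have "\<dots> \<le> (\<Sum>n. hausdorff_pre s \<delta> (A n) + e * (1/2) ^ Suc n)"
    using B by (intro suminf_le order.strict_implies_order) simp_all
  also have "\<dots> = (\<Sum>n. hausdorff_pre s \<delta> (A n)) + (\<Sum>n. ennreal e * ennreal ((1/2) ^ Suc n))"
    using \<open>0 < e\<close> by (subst suminf_add[symmetric])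
                     (auto simp del: ennreal_suminf_cmult simp add: ennreal_mult[symmetric])
  also have "\<dots> = (\<Sum>n. hausdorff_pre s \<delta> (A n)) + e"
    unfolding ennreal_suminf_cmult
    by (subst suminf_ennreal_eq[OF zero_le_power power_half_series]) auto
  finally show "hausdorff_pre s \<delta> (\<Union>i. A i) \<le> (\<Sum>i. hausdorff_pre s \<delta> (A i)) + ennreal e" .
qed

lemma hausdorff_measure_countably_subadditive:
  "hausdorff_measure s (\<Union>i::nat. A i) \<le> (\<Sum>i. hausdorff_measure s (A i))"
proof (rule hausdorff_measure_leI)
  fix \<delta> :: real assume "\<delta> > 0"
  have "hausdorff_pre s \<delta> (\<Union>i. A i) \<le> (\<Sum>i. hausdorff_pre s \<delta> (A i))"
    by (rule hausdorff_pre_countably_subadditive)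
  also have "\<dots> \<le> (\<Sum>i. hausdorff_measure s (A i))"
    using \<open>\<delta> > 0\<close> by (intro suminf_le hausdorff_pre_le_measure) auto
  finally show "hausdorff_pre s \<delta> (\<Union>i. A i) \<le> (\<Sum>i. hausdorff_measure s (A i))" .
qed

text \<open>\<open>S\<close> itself, padded with empty sets, is an admissible cover. The padding is
  free because \<open>diameter {} = 0\<close> and \<open>0 powr s = 0\<close>.\<close>

lemma hausdorff_pre_le_diameter:
  assumes "bounded S" "diameter S \<le> \<delta>" "s > 0"
  shows "hausdorff_pre s \<delta> S \<le> ennreal (diameter S powr s)"
proof -
  have "\<delta> \<ge> 0"
    using assms diameter_ge_0 order_trans by blast
  have "hausdorff_pre s \<delta> S \<le> (\<Sum>i. ennreal (diameter (if i = (0::nat) then S else {}) powr s))"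
    using assms \<open>\<delta> \<ge> 0\<close> by (intro hausdorff_pre_le_suminf) auto
  also have "\<dots> = (\<Sum>i\<in>{0}. ennreal (diameter (if i = (0::nat) then S else {}) powr s))"
    using assms by (intro suminf_finite) auto
  finally show ?thesis by simp
qed

lemma hausdorff_measure_empty [simp]:
  assumes "s > 0"
  shows "hausdorff_measure s {} = 0"
proof -
  have "hausdorff_pre s \<delta> {} \<le> 0" if "\<delta> > 0" for \<delta>
    using hausdorff_pre_le_diameter[of "{}" \<delta> s] assms that by simp
  then have "hausdorff_measure s {} \<le> 0"
    by (rule hausdorff_measure_leI)
  then show ?thesis by simp
qed

lemma hausdorff_measure_Un:
  assumes "s > 0"
  shows "hausdorff_measure s (A \<union> B) \<le> hausdorff_measure s A + hausdorff_measure s B"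
proof -
  have "hausdorff_measure s (\<Union>i. binaryset A B i) \<le> (\<Sum>i. hausdorff_measure s (binaryset A B i))"
    by (rule hausdorff_measure_countably_subadditive)
  also have "(\<Union>i. binaryset A B i) = A \<union> B"
    by (rule UN_binaryset_eq)
  also have "(\<Sum>i. hausdorff_measure s (binaryset A B i))
      = hausdorff_measure s A + hausdorff_measure s B"
    using assms by (intro suminf_binaryset_eq) simp
  finally show ?thesis .
qed

text \<open>A cover \<open>U\<close> of the image under \<open>h\<close> yields the cover by the
  sets \<open>V i\<close>, the images under \<open>g\<close> of the points of \<open>A\<close> that
  \<open>h\<close> sends into \<open>U i\<close>; diameters grow by a factor of at most
  \<open>L\<close>. Using two maps on a bare index type treats Lipschitz maps
  (\<open>h = id\<close>), inverses of maps that do not shrink much (\<open>g = id\<close>), and the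
  comparison of two projections of the same set.\<close>

lemma hausdorff_measure_Lipschitz:
  fixes g :: "'a \<Rightarrow> 'b::metric_space" and h :: "'a \<Rightarrow> 'c::metric_space"
  assumes L: "L > 0" and s: "s > 0"
    and dist: "\<And>x y. \<lbrakk>x \<in> A; y \<in> A\<rbrakk> \<Longrightarrow> dist (g x) (g y) \<le> L * dist (h x) (h y)"
  shows "hausdorff_measure s (g ` A) \<le> ennreal (L powr s) * hausdorff_measure s (h ` A)"
proof (rule hausdorff_measure_leI)
  fix \<delta> :: real assume "\<delta> > 0"
  define \<delta>' where "\<delta>' = \<delta> / L"
  have "\<delta>' > 0" using \<open>\<delta> > 0\<close> L by (simp add: \<delta>'_def)
  have "hausdorff_pre s \<delta> (g ` A) \<le> ennreal (L powr s) * hausdorff_pre s \<delta>' (h ` A)"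
  proof -
    \<comment> \<open>With the factor moved to the left, the claim is a lower bound for an infimum
      over covers.\<close>
    have "hausdorff_pre s \<delta> (g ` A) / ennreal (L powr s) \<le> hausdorff_pre s \<delta>' (h ` A)"
      unfolding hausdorff_pre_def[of s \<delta>' "h ` A"]
    proof (safe intro!: Inf_greatest)
      fix U :: "nat \<Rightarrow> 'c set"
      assume U: "h ` A \<subseteq> \<Union> (range U)" "\<forall>i. bounded (U i) \<and> diameter (U i) \<le> \<delta>'"
      define V where "V i = g ` {x \<in> A. h x \<in> U i}" for i
      have V: "dist u v \<le> L * diameter (U i)" if "u \<in> V i" "v \<in> V i" for u v i
      proof -
        from that obtain x y where "x \<in> A" "y \<in> A" "h x \<in> U i" "h y \<in> U i" "u = g x" "v = g y"
          by (auto simp: V_def)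
        then show ?thesis
          using order_trans[OF dist[of x y] mult_left_mono[OF diameter_bounded_bound[of "U i" "h x" "h y"]]]
            U(2) L by simp
      qed
      have bV: "bounded (V i)" for i
        unfolding bounded_two_points using V by blast
      have dV: "diameter (V i) \<le> L * diameter (U i)" for i
      proof (cases "V i = {}")
        case True
        then show ?thesis using L U(2) diameter_ge_0[of "U i"] by simp
      next
        case False
        then show ?thesis
          by (subst diameter_def) (auto intro!: cSUP_least V)
      qed
      have "hausdorff_pre s \<delta> (g ` A) \<le> (\<Sum>i. ennreal (diameter (V i) powr s))"
      proof (rule hausdorff_pre_le_suminf)
        show "g ` A \<subseteq> \<Union> (range V)"
          using U(1) by (fastforce simp: V_def)
        show "diameter (V i) \<le> \<delta>" for i
        proof -
          have "L * diameter (U i) \<le> L * \<delta>'"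
            using U(2) L by simp
          then show ?thesis
            using dV[of i] L by (simp add: \<delta>'_def)
        qed
      qed (rule bV)
      also have "\<dots> \<le> (\<Sum>i. ennreal (L powr s) * ennreal (diameter (U i) powr s))"
      proof (intro suminf_le)
        show "ennreal (diameter (V i) powr s) \<le> ennreal (L powr s) * ennreal (diameter (U i) powr s)" for i
        proof -
          have "diameter (V i) powr s \<le> (L * diameter (U i)) powr s"
            using s dV[of i] diameter_ge_0[OF bV[of i]] by (intro powr_mono2) auto
          also have "\<dots> = L powr s * diameter (U i) powr s"
            by (rule powr_mult)
          finally show ?thesis
            by (simp add: ennreal_mult[symmetric] ennreal_leI)
        qed
      qed auto
      finally show "hausdorff_pre s \<delta> (g ` A) / ennreal (L powr s) \<le> (\<Sum>i. ennreal (diameter (U i) powr s))"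
        using L by (intro divide_le_posI_ennreal) (auto simp: mult.commute)
    qed
    then have "ennreal (L powr s) * (hausdorff_pre s \<delta> (g ` A) / ennreal (L powr s))
        \<le> ennreal (L powr s) * hausdorff_pre s \<delta>' (h ` A)"
      by (rule mult_left_mono) simp
    also have "ennreal (L powr s) * (hausdorff_pre s \<delta> (g ` A) / ennreal (L powr s)) = hausdorff_pre s \<delta> (g ` A)"
      unfolding ennreal_times_divide mult.commute[of "ennreal (L powr s)"]
      using L by (intro ennreal_mult_divide_eq) auto
    finally show ?thesis .
  qed
  also have "\<dots> \<le> ennreal (L powr s) * hausdorff_measure s (h ` A)"
    using \<open>\<delta>' > 0\<close> by (intro mult_left_mono hausdorff_pre_le_measure) auto
  finally show "hausdorff_pre s \<delta> (g ` A) \<le> ennreal (L powr s) * hausdorff_measure s (h ` A)" .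
qed

lemma hausdorff_measure_isometric:
  fixes g :: "'a \<Rightarrow> 'b::metric_space" and h :: "'a \<Rightarrow> 'c::metric_space"
  assumes "s > 0" and "\<And>x y. \<lbrakk>x \<in> A; y \<in> A\<rbrakk> \<Longrightarrow> dist (g x) (g y) = dist (h x) (h y)"
  shows "hausdorff_measure s (g ` A) = hausdorff_measure s (h ` A)"
  using hausdorff_measure_Lipschitz[of 1 s A g h] hausdorff_measure_Lipschitz[of 1 s A h g] assms
  by (intro antisym) auto

section \<open>Comparison with Lebesgue measure\<close>

text \<open>A bound on the pieces passes to the union, since overlaps are null and the Lebesgue
  measures of the pieces add up. \<open>G\<close> is kept abstract because it is used both for
  \<open>hausdorff_pre\<close> at a fixed scale and for \<open>hausdorff_measure\<close>.\<close>

lemma countably_subadditive_le_measure: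
  fixes G :: "'a::euclidean_space set \<Rightarrow> ennreal"
  assumes G: "\<And>A. G (\<Union>n::nat. A n) \<le> (\<Sum>n. G (A n))" and "G {} = 0"
    and D: "countable \<D>" "bounded (\<Union>\<D>)" "pairwise (\<lambda>A B. negligible (A \<inter> B)) \<D>"
      "\<And>K. K \<in> \<D> \<Longrightarrow> K \<in> lmeasurable"
    and le: "\<And>K. K \<in> \<D> \<Longrightarrow> G K \<le> ennreal (C * measure lebesgue K)" and C: "C \<ge> 0"
  shows "G (\<Union>\<D>) \<le> ennreal (C * measure lebesgue (\<Union>\<D>))"
proof -
  \<comment> \<open>The family may be finite, so it is enumerated through an injection into the
    naturals, with empty sets at the remaining indices.\<close>
  define A where "A n = (if n \<in> to_nat_on \<D> ` \<D> then from_nat_into \<D> n else {})" for n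
  have inj: "inj_on (to_nat_on \<D>) \<D>"
    using D(1) by (rule inj_on_to_nat_on)
  have A_D: "A n \<in> \<D> \<or> A n = {}" for n
    using D(1) by (auto simp: A_def)
  have UA: "(\<Union>n. A n) = \<Union>\<D>"
  proof
    show "(\<Union>n. A n) \<subseteq> \<Union>\<D>"
      using A_D by blast
    show "\<Union>\<D> \<subseteq> (\<Union>n. A n)"
    proof
      fix x assume "x \<in> \<Union>\<D>"
      then obtain K where K: "K \<in> \<D>" "x \<in> K" by blast
      then have "A (to_nat_on \<D> K) = K"
        using D(1) by (simp add: A_def)
      then show "x \<in> (\<Union>n. A n)" using K by blast
    qed
  qed
  have meas: "A n \<in> lmeasurable" for n
    using A_D[of n] D(4) by fastforce
  have "pairwise (\<lambda>m n. negligible (A m \<inter> A n)) UNIV"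
  proof (rule pairwiseI)
    fix m n :: nat assume "m \<noteq> n"
    show "negligible (A m \<inter> A n)"
    proof (cases "m \<in> to_nat_on \<D> ` \<D> \<and> n \<in> to_nat_on \<D> ` \<D>")
      case True
      then obtain K L where "K \<in> \<D>" "L \<in> \<D>" "m = to_nat_on \<D> K" "n = to_nat_on \<D> L" by blast
      then show ?thesis
        using D \<open>m \<noteq> n\<close> by (auto simp: A_def pairwise_def)
    qed (auto simp: A_def)
  qed
  then have sums: "(\<lambda>n. measure lebesgue (A n)) sums measure lebesgue (\<Union>n. A n)"
    using meas D(2) UA by (intro measure_countable_negligible_Union_bounded) auto
  have "G (\<Union>n. A n) \<le> (\<Sum>n. G (A n))"
    by (rule G)
  also have "\<dots> \<le> (\<Sum>n. ennreal (C * measure lebesgue (A n)))"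
  proof (rule suminf_le)
    show "G (A n) \<le> ennreal (C * measure lebesgue (A n))" for n
      using A_D[of n] le \<open>G {} = 0\<close> by auto
  qed auto
  also have "\<dots> = ennreal (\<Sum>n. C * measure lebesgue (A n))"
    using C sums by (intro suminf_ennreal2 summable_mult) (auto simp: sums_iff)
  also have "(\<Sum>n. C * measure lebesgue (A n)) = C * measure lebesgue (\<Union>n. A n)"
    using sums by (simp add: suminf_mult sums_iff)
  finally show ?thesis by (simp add: UA)
qed

section \<open>Cubes: scaling, volume, and finiteness of the Hausdorff measure\<close>

lemma hausdorff_measure_scaling:
  fixes A :: "'a::real_normed_vector set"
  assumes "r > 0" "s > 0"
  shows "hausdorff_measure s ((\<lambda>x. a + r *\<^sub>R x) ` A) = ennreal (r powr s) * hausdorff_measure s A"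
proof (rule antisym)
  show "hausdorff_measure s ((\<lambda>x. a + r *\<^sub>R x) ` A) \<le> ennreal (r powr s) * hausdorff_measure s A"
    using hausdorff_measure_Lipschitz[of r s A "\<lambda>x. a + r *\<^sub>R x" id] assms
    by (simp add: dist_norm flip: scaleR_diff_right)
  have "hausdorff_measure s A \<le> ennreal ((1/r) powr s) * hausdorff_measure s ((\<lambda>x. a + r *\<^sub>R x) ` A)"
    using hausdorff_measure_Lipschitz[of "1/r" s A id "\<lambda>x. a + r *\<^sub>R x"] assms
    by (simp add: dist_norm flip: scaleR_diff_right)
  then have "ennreal (r powr s) * hausdorff_measure s A
     \<le> ennreal (r powr s) * (ennreal ((1/r) powr s) * hausdorff_measure s ((\<lambda>x. a + r *\<^sub>R x) ` A))"
    by (rule mult_left_mono) simp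
  also have "\<dots> = ennreal (r powr s * (1/r) powr s) * hausdorff_measure s ((\<lambda>x. a + r *\<^sub>R x) ` A)"
    by (simp add: ennreal_mult mult.assoc)
  also have "r powr s * (1/r) powr s = 1"
    using assms by (simp flip: powr_mult)
  finally show "ennreal (r powr s) * hausdorff_measure s A \<le> hausdorff_measure s ((\<lambda>x. a + r *\<^sub>R x) ` A)"
    by simp
qed

lemma cbox_eq_scaled_unit_cube:
  fixes u v :: "'a::euclidean_space"
  assumes "r > 0" "\<And>i. i \<in> Basis \<Longrightarrow> v \<bullet> i - u \<bullet> i = r"
  shows "cbox u v = (\<lambda>x. u + r *\<^sub>R x) ` cbox 0 One"
proof -
  have "u + r *\<^sub>R One = v"
  proof (rule euclidean_eqI)
    fix i :: 'a assume "i \<in> Basis"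
    then show "(u + r *\<^sub>R One) \<bullet> i = v \<bullet> i"
      using assms(2)[of i] by (simp add: inner_add_left algebra_simps)
  qed
  then show ?thesis
    using image_affinity_cbox[of r u 0 One] assms(1)
    by (simp add: add.commute flip: box_ne_empty(1))
qed

lemma content_cube:
  fixes u v :: "'a::euclidean_space"
  assumes "r \<ge> 0" "\<And>i. i \<in> Basis \<Longrightarrow> v \<bullet> i - u \<bullet> i = r"
  shows "measure lebesgue (cbox u v) = r ^ DIM('a)"
proof -
  have "u \<bullet> i \<le> v \<bullet> i" if "i \<in> Basis" for i
    using assms(1) assms(2)[OF that] by simp
  moreover have "(\<Prod>i\<in>Basis. (v - u) \<bullet> i) = (\<Prod>i\<in>(Basis::'a set). r)"
    by (rule prod.cong) (simp_all add: inner_diff_left assms)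
  ultimately show ?thesis
    by (simp add: content_cbox)
qed

text \<open>Hausdorff measure of dimension \<open>DIM('a)\<close> and Lebesgue measure both scale by
  the same power of the side length, so their ratio is the same for all cubes.\<close>

lemma hausdorff_measure_cube:
  fixes u v :: "'a::euclidean_space"
  assumes "r > 0" "\<And>i. i \<in> Basis \<Longrightarrow> v \<bullet> i - u \<bullet> i = r"
  shows "hausdorff_measure (real DIM('a)) (cbox u v)
      = ennreal (measure lebesgue (cbox u v)) * hausdorff_measure (real DIM('a)) (cbox 0 (One::'a))"
proof -
  have "measure lebesgue (cbox u v) = r ^ DIM('a)"
    using assms by (intro content_cube) auto
  moreover have "r powr real DIM('a) = r ^ DIM('a)"
    using assms(1) by (simp add: powr_realpow)
  moreover have "hausdorff_measure (real DIM('a)) ((\<lambda>x. u + r *\<^sub>R x) ` cbox 0 (One::'a))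
      = ennreal (r powr real DIM('a)) * hausdorff_measure (real DIM('a)) (cbox 0 (One::'a))"
    using assms(1) by (intro hausdorff_measure_scaling) auto
  ultimately show ?thesis
    using cbox_eq_scaled_unit_cube[OF assms] by simp
qed

text \<open>The crude bound by the 1-norm suffices, as it only serves to prove finiteness.\<close>

lemma diameter_cube_le:
  fixes u v :: "'a::euclidean_space"
  assumes "r \<ge> 0" "\<And>i. i \<in> Basis \<Longrightarrow> v \<bullet> i - u \<bullet> i = r"
  shows "diameter (cbox u v) \<le> real DIM('a) * r"
proof -
  have "u \<bullet> i \<le> v \<bullet> i" if "i \<in> Basis" for i
    using assms(1) assms(2)[OF that] by simp
  then have "diameter (cbox u v) = dist u v"
    by (intro diameter_cbox) auto
  also have "\<dots> = norm (v - u)"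
    by (simp add: dist_norm norm_minus_commute)
  also have "\<dots> \<le> (\<Sum>i\<in>Basis. \<bar>(v - u) \<bullet> i\<bar>)"
    by (rule norm_le_l1)
  also have "\<dots> = real DIM('a) * r"
    using assms by (simp add: inner_simps)
  finally show ?thesis .
qed

text \<open>The intersection of two boxes is convex, and a convex set with empty interior is
  null.\<close>

lemma interior_disjoint_cboxes_negligible:
  fixes \<D> :: "'a::euclidean_space set set"
  assumes "pairwise (\<lambda>A B. interior A \<inter> interior B = {}) \<D>"
    and "\<And>K. K \<in> \<D> \<Longrightarrow> \<exists>u v. K = cbox u v"
  shows "pairwise (\<lambda>A B. negligible (A \<inter> B)) \<D>"
proof (rule pairwiseI)
  fix A B assume AB: "A \<in> \<D>" "B \<in> \<D>" "A \<noteq> B"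
  then have "convex A" "convex B"
    using assms(2) by fastforce+
  moreover have "interior A \<inter> interior B = {}"
    using assms(1) AB by (simp add: pairwise_def)
  ultimately show "negligible (A \<inter> B)"
    by (simp add: negligible_convex_interior convex_Int)
qed

text \<open>Subdivide into dyadic cubes of diameter at most \<open>\<delta>\<close>. A cube of
  dimension \<open>d\<close> satisfies diameter^d \<le> d^d * volume, so the sum is at most
  \<open>d^d\<close> at every scale.\<close>

lemma hausdorff_measure_unit_cube_finite:
  "hausdorff_measure (real DIM('a)) (cbox 0 (One::'a::euclidean_space)) < \<infinity>"
proof -
  let ?d = "real DIM('a)"
  have "hausdorff_measure ?d (cbox 0 (One::'a)) \<le> ennreal (?d powr ?d)"
  proof (rule hausdorff_measure_leI)
    fix \<delta> :: real assume "\<delta> > 0"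
    \<comment> \<open>This gauge puts every cube of the subdivision into a ball of radius
      \<open>\<delta>/2\<close>, so its diameter is at most \<open>\<delta>\<close>.\<close>
    then have g: "gauge (\<lambda>x::'a. ball x (\<delta>/2))"
      by (simp add: gauge_def)
    have b: "box 0 (One::'a) \<noteq> {}"
      by (simp add: box_ne_empty)
    show "hausdorff_pre ?d \<delta> (cbox 0 (One::'a)) \<le> ennreal (?d powr ?d)"
    proof (rule covering_lemma[OF order_refl b g])
      fix \<D> assume D: "countable \<D>" "\<Union>\<D> \<subseteq> cbox 0 (One::'a)"
          "\<And>K. K \<in> \<D> \<Longrightarrow> interior K \<noteq> {} \<and> (\<exists>c d. K = cbox c d)"
          "pairwise (\<lambda>A B. interior A \<inter> interior B = {}) \<D>"
          "\<And>K. K \<in> \<D> \<Longrightarrow> \<exists>x \<in> cbox 0 One \<inter> K. K \<subseteq> ball x (\<delta>/2)"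
          "\<And>u v. cbox u v \<in> \<D> \<Longrightarrow> \<exists>n. \<forall>i \<in> Basis. v \<bullet> i - u \<bullet> i = (One \<bullet> i - 0 \<bullet> i) / 2^n"
          "cbox 0 One \<subseteq> \<Union>\<D>"
      have UD: "\<Union>\<D> = cbox 0 One" using D by blast
      have "hausdorff_pre ?d \<delta> (\<Union>\<D>) \<le> ennreal (?d powr ?d * measure lebesgue (\<Union>\<D>))"
      proof (rule countably_subadditive_le_measure[OF hausdorff_pre_countably_subadditive])
        show "hausdorff_pre ?d \<delta> ({}::'a set) = 0"
          using hausdorff_pre_le_diameter[of "{}::'a set" \<delta> ?d] \<open>\<delta> > 0\<close> by simp
        show "bounded (\<Union>\<D>)" by (simp add: UD)
        show "pairwise (\<lambda>A B. negligible (A \<inter> B)) \<D>"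
          using interior_disjoint_cboxes_negligible D(3,4) by blast
        fix K assume K: "K \<in> \<D>"
        then obtain u v where uv: "K = cbox u v" using D(3) by blast
        then show "K \<in> lmeasurable" by simp
        obtain n where n: "\<And>i. i \<in> Basis \<Longrightarrow> v \<bullet> i - u \<bullet> i = 1 / 2^n"
          using D(6)[of u v] K uv by auto
        have m: "measure lebesgue K = (1 / 2^n) ^ DIM('a)"
          unfolding uv by (intro content_cube n) auto
        obtain x where "K \<subseteq> ball x (\<delta>/2)"
          using D(5) K by blast
        then have "diameter K \<le> diameter (ball x (\<delta>/2))"
          by (intro diameter_subset) auto
        then have "hausdorff_pre ?d \<delta> K \<le> ennreal (diameter K powr ?d)"
          using \<open>\<delta> > 0\<close> by (intro hausdorff_pre_le_diameter) (auto simp: uv)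
        also have "diameter K powr ?d \<le> (?d * (1 / 2^n)) powr ?d"
          using diameter_cube_le[of "1/2^n" v u] n
          by (intro powr_mono2) (auto simp: uv intro!: diameter_ge_0)
        also have "\<dots> = ?d powr ?d * measure lebesgue K"
          by (subst powr_mult) (simp add: m powr_realpow)
        finally show "hausdorff_pre ?d \<delta> K \<le> ennreal (?d powr ?d * measure lebesgue K)"
          by (simp add: ennreal_leI)
      qed (use D in auto)
      then show "hausdorff_pre ?d \<delta> (cbox 0 (One::'a)) \<le> ennreal (?d powr ?d)"
        by (simp add: UD content_cube[of 1])
    qed
  qed
  then show ?thesis
    using le_less_trans by fastforce
qed

text \<open>The ratio of Hausdorff to Lebesgue measure in top dimension. \<open>enn2real\<close>
  loses nothing because the cube has finite measure.\<close>

definition hausdorff_cube_const :: "'a::euclidean_space itself \<Rightarrow> real" where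
  "hausdorff_cube_const _ = enn2real (hausdorff_measure (real DIM('a)) (cbox 0 (One::'a)))"

lemma hausdorff_cube_const_nonneg [simp]: "hausdorff_cube_const TYPE('a::euclidean_space) \<ge> 0"
  by (simp add: hausdorff_cube_const_def)

lemma hausdorff_measure_unit_cube:
  "hausdorff_measure (real DIM('a)) (cbox 0 (One::'a::euclidean_space))
    = ennreal (hausdorff_cube_const TYPE('a))"
  unfolding hausdorff_cube_const_def
  using hausdorff_measure_unit_cube_finite[where 'a = 'a] by (simp add: less_top)

lemma hausdorff_measure_cube_eq_lebesgue:
  fixes u v :: "'a::euclidean_space"
  assumes "r > 0" "\<And>i. i \<in> Basis \<Longrightarrow> v \<bullet> i - u \<bullet> i = r"
  shows "hausdorff_measure (real DIM('a)) (cbox u v)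
      = ennreal (hausdorff_cube_const TYPE('a) * measure lebesgue (cbox u v))"
  using hausdorff_measure_cube[OF assms]
  by (simp only: hausdorff_measure_unit_cube mult.commute[of "ennreal (measure _ _)"]
      ennreal_mult hausdorff_cube_const_nonneg measure_nonneg)

section \<open>Proportionality of Hausdorff and Lebesgue measure\<close>

lemma bounded_subset_cube:
  fixes A :: "'a::euclidean_space set"
  assumes "bounded A"
  obtains R where "R > 0" "A \<subseteq> cbox (- R *\<^sub>R One) (R *\<^sub>R One)"
proof -
  obtain R where R: "R > 0" "\<And>x. x \<in> A \<Longrightarrow> norm x \<le> R"
    using assms bounded_pos by metis
  have "A \<subseteq> cbox (- R *\<^sub>R One) (R *\<^sub>R One)"
  proof
    fix x assume "x \<in> A"
    then have "\<bar>x \<bullet> i\<bar> \<le> R" if "i \<in> Basis" for i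
      using R(2) Basis_le_norm[OF that, of x] by fastforce
    then show "x \<in> cbox (- R *\<^sub>R One) (R *\<^sub>R One)"
      by (auto simp: mem_box abs_le_iff minus_le_iff)
  qed
  with R(1) show thesis by (rule that)
qed

text \<open>Cover \<open>A\<close> by dyadic cubes of total volume close to that of
  \<open>A\<close>; on each cube the ratio of the two measures is exactly the constant.\<close>

lemma hausdorff_measure_le_lebesgue:
  fixes A :: "'a::euclidean_space set"
  assumes "A \<in> lmeasurable" "bounded A"
  shows "hausdorff_measure (real DIM('a)) A \<le> ennreal (hausdorff_cube_const TYPE('a) * measure lebesgue A)"
proof (rule ennreal_le_epsilon)
  fix e :: real assume "e > 0"
  let ?d = "real DIM('a)" and ?C = "hausdorff_cube_const TYPE('a)"
  obtain R where R: "R > 0" "A \<subseteq> cbox (- R *\<^sub>R One) (R *\<^sub>R One)"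
    using bounded_subset_cube[OF assms(2)] .
  \<comment> \<open>The \<open>+ 1\<close> avoids a division by zero and still gives
    \<open>?C * e' \<le> e\<close>.\<close>
  define e' where "e' = e / (?C + 1)"
  have "e' > 0" and e': "?C * e' \<le> e"
    using \<open>e > 0\<close> hausdorff_cube_const_nonneg[where 'a = 'a]
    by (auto simp: e'_def divide_simps algebra_simps add_pos_nonneg add_nonneg_pos)
  have ne: "box (- R *\<^sub>R One) (R *\<^sub>R One :: 'a) \<noteq> {}"
    using R(1) by (simp add: box_ne_empty)
  show "hausdorff_measure ?d A \<le> ennreal (?C * measure lebesgue A) + ennreal e"
  proof (rule measurable_outer_intervals_bounded[OF assms(1) R(2) \<open>e' > 0\<close>])
    fix \<D> assume D: "countable \<D>"
        "\<And>K. K \<in> \<D> \<Longrightarrow> K \<subseteq> cbox (- R *\<^sub>R One) (R *\<^sub>R One) \<and> K \<noteq> {} \<and> (\<exists>c d. K = cbox c d)"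
        "pairwise (\<lambda>A B. interior A \<inter> interior B = {}) \<D>"
        "\<And>u v. cbox u v \<in> \<D> \<Longrightarrow>
          \<exists>n. \<forall>i\<in>Basis. v \<bullet> i - u \<bullet> i = ((R *\<^sub>R One) \<bullet> i - (- R *\<^sub>R One :: 'a) \<bullet> i) / 2 ^ n"
        "A \<subseteq> \<Union>\<D>" "\<Union>\<D> \<in> lmeasurable"
        "measure lebesgue (\<Union>\<D>) \<le> measure lebesgue A + e'"
    have "hausdorff_measure ?d A \<le> hausdorff_measure ?d (\<Union>\<D>)"
      by (rule hausdorff_measure_mono[OF D(5)])
    also have "\<dots> \<le> ennreal (?C * measure lebesgue (\<Union>\<D>))"
    proof (rule countably_subadditive_le_measure[OF hausdorff_measure_countably_subadditive])
      show "bounded (\<Union>\<D>)"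
        using D(2) by (meson Sup_least bounded_cbox bounded_subset)
      show "pairwise (\<lambda>A B. negligible (A \<inter> B)) \<D>"
        using interior_disjoint_cboxes_negligible D(2,3) by blast
      fix K assume K: "K \<in> \<D>"
      then obtain u v where uv: "K = cbox u v" using D(2) by blast
      then show "K \<in> lmeasurable" by simp
      obtain n where "\<And>i. i \<in> Basis \<Longrightarrow> v \<bullet> i - u \<bullet> i = 2 * R / 2 ^ n"
        using D(4)[of u v] K uv by auto
      then show "hausdorff_measure ?d K \<le> ennreal (?C * measure lebesgue K)"
        unfolding uv using R(1)
        by (intro eq_refl hausdorff_measure_cube_eq_lebesgue[of "2 * R / 2 ^ n"]) auto
    qed (use D in auto)
    also have "?C * measure lebesgue (\<Union>\<D>) \<le> ?C * measure lebesgue A + e"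
      using mult_left_mono[OF D(7), of ?C] e' by (simp add: algebra_simps)
    finally show ?thesis
      using \<open>e > 0\<close> by (simp add: ennreal_leI ennreal_plus[symmetric] del: ennreal_plus)
  qed
qed

text \<open>The upper bound, applied to the complement of the set in a cube, also yields the lower bound.\<close>

lemma hausdorff_measure_eq_lebesgue:
  fixes A :: "'a::euclidean_space set"
  assumes A: "A \<in> lmeasurable" "bounded A"
  shows "hausdorff_measure (real DIM('a)) A = ennreal (hausdorff_cube_const TYPE('a) * measure lebesgue A)"
proof (rule antisym[OF hausdorff_measure_le_lebesgue[OF A]])
  let ?d = "real DIM('a)" and ?C = "hausdorff_cube_const TYPE('a)" and ?m = "measure lebesgue"
  obtain R where R: "R > 0" "A \<subseteq> cbox (- R *\<^sub>R One) (R *\<^sub>R One)"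
    using bounded_subset_cube[OF A(2)] .
  define Q :: "'a set" where "Q = cbox (- R *\<^sub>R One) (R *\<^sub>R One)"
  have Q: "Q \<in> lmeasurable" "A \<subseteq> Q" "bounded Q"
    using R by (auto simp: Q_def)
  \<comment> \<open>A real value \<open>h\<close> is needed so that the volume of \<open>Q\<close>
    can be cancelled below.\<close>
  have "hausdorff_measure ?d A \<noteq> top"
    using hausdorff_measure_le_lebesgue[OF A] by (auto simp: top_unique)
  then obtain h where h: "h \<ge> 0" "hausdorff_measure ?d A = ennreal h"
    by (cases "hausdorff_measure ?d A") auto
  have "ennreal (?C * ?m Q) = hausdorff_measure ?d Q"
    unfolding Q_def using R(1)
    by (intro hausdorff_measure_cube_eq_lebesgue[of "2 * R", symmetric]) auto
  also have "\<dots> \<le> hausdorff_measure ?d (A \<union> (Q - A))"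
    by (rule hausdorff_measure_mono) auto
  also have "\<dots> \<le> hausdorff_measure ?d A + hausdorff_measure ?d (Q - A)"
    by (rule hausdorff_measure_Un) simp
  also have "hausdorff_measure ?d (Q - A) \<le> ennreal (?C * ?m (Q - A))"
    using A Q by (intro hausdorff_measure_le_lebesgue) (auto intro: bounded_subset)
  also have "?m (Q - A) = ?m Q - ?m A"
    using A Q by (intro measurable_measure_Diff) (auto simp: fmeasurableD)
  finally have "ennreal (?C * ?m Q) \<le> ennreal (h + ?C * (?m Q - ?m A))"
    using A Q h by (simp add: ennreal_plus[symmetric] measure_mono_fmeasurable fmeasurableD del: ennreal_plus)
  moreover have "0 \<le> h + ?C * (?m Q - ?m A)"
    using A Q h by (auto intro!: add_nonneg_nonneg mult_nonneg_nonneg measure_mono_fmeasurable fmeasurableD)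
  ultimately have "?C * ?m Q \<le> h + ?C * (?m Q - ?m A)"
    by (simp only: ennreal_le_iff)
  then show "ennreal (?C * ?m A) \<le> hausdorff_measure ?d A"
    by (simp add: h algebra_simps ennreal_leI)
qed

text \<open>By Vitali, disjoint balls of diameter at most \<open>\<delta>\<close> fill the cube up
  to a null set. For each ball, diameter^d is \<open>sigma_const d\<close> times its volume, and the
  null set contributes nothing.\<close>

lemma hausdorff_cube_const_le_sigma_const:
  "hausdorff_cube_const TYPE('a::euclidean_space) \<le> sigma_const DIM('a)"
proof -
  let ?d = "real DIM('a)" and ?Q = "cbox 0 (One::'a)" and ?\<sigma> = "sigma_const DIM('a)"
  have "Gamma (?d / 2 + 1) > 0"
    by (rule Gamma_real_pos) (simp add: add_nonneg_pos)
  note G = this this[THEN less_imp_neq, symmetric]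
  have \<sigma>: "?\<sigma> * unit_ball_vol ?d = 2 ^ DIM('a)" and \<sigma>0: "?\<sigma> \<ge> 0"
    using G by (simp_all add: sigma_const_def unit_ball_vol_def)
  have "hausdorff_measure ?d ?Q \<le> ennreal ?\<sigma>"
  proof (rule hausdorff_measure_leI)
    fix \<delta> :: real assume "\<delta> > 0"
    \<comment> \<open>Pairs of centre and radius: the radius bound keeps diameters below
      \<open>\<delta>\<close>, and containment in the cube keeps the total volume at most
      \<open>1\<close>.\<close>
    define K where "K = {(x::'a, r). 0 < r \<and> r \<le> \<delta> / 2 \<and> cball x r \<subseteq> ?Q}"
    have K: "\<exists>i. i \<in> K \<and> x \<in> cball (fst i) (snd i) \<and> snd i < t" if "x \<in> box 0 One" "t > 0" for x t
    proof -
      obtain e where e: "e > 0" "cball x e \<subseteq> box 0 One"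
        using open_contains_cball[of "box 0 (One::'a)"] open_box \<open>x \<in> box 0 One\<close> by blast
      \<comment> \<open>\<open>e\<close> keeps the ball in the cube, \<open>\<delta> / 2\<close>
        puts it into \<open>K\<close>, and \<open>t / 2\<close> makes the radius strictly smaller
        than \<open>t\<close>.\<close>
      define r where "r = min e (min (\<delta> / 2) (t / 2))"
      have "cball x r \<subseteq> cball x e"
        by (rule subset_cball) (simp add: r_def)
      then have "(x, r) \<in> K"
        using e \<open>t > 0\<close> \<open>\<delta> > 0\<close> box_subset_cbox[of 0 "One::'a"] by (auto simp: K_def r_def)
      then show ?thesis
        using e \<open>t > 0\<close> \<open>\<delta> > 0\<close> by (intro exI[of _ "(x, r)"]) (auto simp: r_def)
    qed
    show "hausdorff_pre ?d \<delta> ?Q \<le> ennreal ?\<sigma>"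
    proof (rule Vitali_covering_theorem_cballs[of K snd "box 0 One" fst, OF _ K])
      fix B assume B: "countable B" "B \<subseteq> K"
         "pairwise (\<lambda>i j. disjnt (cball (fst i) (snd i)) (cball (fst j) (snd j))) B"
         "negligible (box 0 One - (\<Union>i\<in>B. cball (fst i) (snd i)))"
      define D where "D = (\<lambda>i. cball (fst i) (snd i)) ` B"
      \<comment> \<open>The part of the cube outside the balls: boundary points and the interior
        points missed by Vitali, both null.\<close>
      define N where "N = ?Q - \<Union>D"
      have "N \<subseteq> (box 0 One - (\<Union>i\<in>B. cball (fst i) (snd i))) \<union> (?Q - box 0 One)"
        by (auto simp: N_def D_def)
      then have N: "negligible N"
        using B(4) negligible_frontier_interval[of 0 "One::'a"]
        by (meson negligible_Un negligible_subset)
      have DQ: "\<Union>D \<subseteq> ?Q"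
        using B(2) by (force simp: D_def K_def)
      then have UD: "\<Union>(insert N D) = ?Q"
        by (auto simp: N_def)
      have "hausdorff_pre ?d \<delta> (\<Union>(insert N D)) \<le> ennreal (?\<sigma> * measure lebesgue (\<Union>(insert N D)))"
      proof (rule countably_subadditive_le_measure[OF hausdorff_pre_countably_subadditive])
        show "hausdorff_pre ?d \<delta> ({}::'a set) = 0"
          using hausdorff_pre_le_diameter[of "{}::'a set" \<delta> ?d] \<open>\<delta> > 0\<close> by simp
        show "countable (insert N D)"
          using B(1) by (simp add: D_def)
        show "bounded (\<Union>(insert N D))"
          unfolding UD by simp
        have "pairwise (\<lambda>A B. negligible (A \<inter> B)) D"
          unfolding D_def by (intro pairwise_imageI) (use B(3) in \<open>auto simp: pairwise_def disjnt_def\<close>)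
        then show "pairwise (\<lambda>A B. negligible (A \<inter> B)) (insert N D)"
          using N by (auto simp: pairwise_insert negligible_Int)
        show "?\<sigma> \<ge> 0" by (rule \<sigma>0)
        fix L assume L: "L \<in> insert N D"
        then show "L \<in> lmeasurable"
          using N by (auto simp: D_def negligible_imp_measurable)
        show "hausdorff_pre ?d \<delta> L \<le> ennreal (?\<sigma> * measure lebesgue L)"
        proof (cases "L = N")
          case True
          have "hausdorff_pre ?d \<delta> N \<le> hausdorff_measure ?d N"
            using \<open>\<delta> > 0\<close> by (rule hausdorff_pre_le_measure)
          also have "\<dots> = 0"
            using N by (subst hausdorff_measure_eq_lebesgue)
              (auto simp: negligible_imp_measurable negligible_imp_measure0 N_def)
          finally show ?thesis by (simp add: True)
        next
          case False
          then obtain i where i: "i \<in> B" "L = cball (fst i) (snd i)"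
            using L by (auto simp: D_def)
          then obtain x r where xr: "L = cball x r" "0 < r" "r \<le> \<delta> / 2"
            using B(2) by (cases i) (auto simp: K_def)
          have "hausdorff_pre ?d \<delta> L \<le> ennreal (diameter L powr ?d)"
            using xr by (intro hausdorff_pre_le_diameter) auto
          also have "diameter L powr ?d = 2 ^ DIM('a) * r ^ DIM('a)"
            using xr by (simp add: powr_realpow power_mult_distrib)
          also have "\<dots> = ?\<sigma> * measure lebesgue L"
            using xr content_cball[of r x] by (simp flip: \<sigma>)
          finally show ?thesis .
        qed
      qed
      then show ?thesis
        unfolding UD by (simp add: content_cube[of 1])
    qed (auto simp: K_def)
  qed
  then show ?thesis
    using \<sigma>0 by (simp add: hausdorff_measure_unit_cube)
qed

section \<open>Additivity and measurability of pieces\<close>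

lemma hausdorff_measure_disjoint_UN:
  fixes A :: "nat \<Rightarrow> 'a::euclidean_space set"
  assumes "\<And>i. A i \<in> lmeasurable" "disjoint_family A" "bounded (\<Union>i. A i)"
  shows "(\<Sum>i. hausdorff_measure (real DIM('a)) (A i)) = hausdorff_measure (real DIM('a)) (\<Union>i. A i)"
proof -
  let ?C = "hausdorff_cube_const TYPE('a)" and ?m = "measure lebesgue"
  have neg: "pairwise (\<lambda>m n. negligible (A m \<inter> A n)) UNIV"
    using assms(2) by (auto simp: pairwise_def disjoint_family_on_def)
  have sums: "(\<lambda>i. ?m (A i)) sums ?m (\<Union>i. A i)"
    using assms neg by (intro measure_countable_negligible_Union_bounded) auto
  have b: "bounded (A i)" for i
    using assms(3) by (rule bounded_subset) auto
  have "(\<Sum>i. hausdorff_measure (real DIM('a)) (A i)) = (\<Sum>i. ennreal (?C * ?m (A i)))"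
    using assms b by (simp add: hausdorff_measure_eq_lebesgue)
  also have "\<dots> = ennreal (\<Sum>i. ?C * ?m (A i))"
    using sums by (intro suminf_ennreal2 summable_mult) (auto simp: sums_iff)
  also have "(\<Sum>i. ?C * ?m (A i)) = ?C * ?m (\<Union>i. A i)"
    using sums by (simp add: suminf_mult sums_iff)
  also have "ennreal \<dots> = hausdorff_measure (real DIM('a)) (\<Union>i. A i)"
    using assms neg measurable_countable_negligible_Union_bounded[of A]
    by (simp add: hausdorff_measure_eq_lebesgue)
  finally show ?thesis .
qed

text \<open>This is why pieces of \<open>S\<close> are taken as differences of compact sets: an
  injective continuous image of such a difference is again one, hence measurable.\<close>

lemma inj_image_compact_Diff_lmeasurable:
  fixes f :: "'a::t2_space \<Rightarrow> 'b::euclidean_space"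
  assumes "compact K" "compact K'" "K' \<subseteq> K" "continuous_on K f" "inj_on f K"
  shows "f ` (K - K') \<in> lmeasurable" "bounded (f ` (K - K'))"
proof -
  have "compact (f ` K)" "compact (f ` K')"
    using assms compact_continuous_image continuous_on_subset by blast+
  moreover have "f ` (K - K') = f ` K - f ` K'"
    using inj_on_image_set_diff[OF assms(5), of K K'] assms(3) by auto
  ultimately show "f ` (K - K') \<in> lmeasurable" "bounded (f ` (K - K'))"
    by (simp_all add: fmeasurable.Diff lmeasurable_compact bounded_diff compact_imp_bounded)
qed

section \<open>Coordinate projections of hyperplanes\<close>

lemma linear_isometry_inner:
  fixes f :: "'a::real_inner \<Rightarrow> 'b::real_inner"
  assumes "linear f" "\<And>x. norm (f x) = norm x"
  shows "f x \<bullet> f y = x \<bullet> y"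
  by (simp add: dot_norm assms flip: linear_add[OF assms(1)])

text \<open>The hypothesis says that the Gram matrix of \<open>f\<close> is the identity minus the
  rank-one matrix of \<open>w\<close>, whose determinant is \<open>1 - w \<bullet> w\<close>. It is
  applied to a coordinate projection between hyperplanes, written in orthonormal
  coordinates.\<close>

lemma det_sq_of_inner_defect:
  fixes f :: "real ^ 'n \<Rightarrow> real ^ 'n"
  assumes f: "linear f" and inner: "\<And>x y. f x \<bullet> f y = x \<bullet> y - (w \<bullet> x) * (w \<bullet> y)"
  shows "(det (matrix f))\<^sup>2 = 1 - w \<bullet> w"
proof -
  \<comment> \<open>Rotating \<open>w\<close> onto a coordinate axis makes the Gram matrix of \<open>f\<close> diagonal.\<close>
  obtain k :: 'n where True by simp
  define a :: "real ^ 'n" where "a = norm w *\<^sub>R axis k 1"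
  have "norm a = norm w"
    by (simp add: a_def)
  then obtain h where h: "orthogonal_transformation h" "h a = w"
    by (rule orthogonal_transformation_exists)
  define g where "g = f \<circ> h"
  have lg: "linear h" "linear g"
    using h(1) f by (auto simp: g_def orthogonal_transformation_def intro: linear_compose)
  have inner_g: "g x \<bullet> g y = x \<bullet> y - (a \<bullet> x) * (a \<bullet> y)" for x y
    using h by (auto simp: g_def inner orthogonal_transformation_def simp flip: h(2))
  let ?G = "transpose (matrix g) ** matrix g"
  have entry: "?G $ i $ j = (if i = j then if i = k then 1 - w \<bullet> w else 1 else 0)" for i j
  proof -
    have "?G $ i $ j = g (axis i 1) \<bullet> g (axis j 1)"
      by (simp add: matrix_matrix_mult_def transpose_def matrix_def inner_vec_def)
    also have "\<dots> = (if i = j then if i = k then 1 - w \<bullet> w else 1 else 0)"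
      by (auto simp: inner_g a_def inner_axis_axis dot_square_norm power2_eq_square)
    finally show ?thesis .
  qed
  have "(det (matrix g))\<^sup>2 = det ?G"
    by (simp add: det_mul power2_eq_square)
  also have "\<dots> = (\<Prod>i\<in>UNIV. ?G $ i $ i)"
    by (rule det_diagonal) (simp add: entry)
  also have "\<dots> = 1 - w \<bullet> w"
    by (simp add: entry prod.delta)
  finally have "(det (matrix g))\<^sup>2 = 1 - w \<bullet> w" .
  moreover have "matrix g = matrix f ** matrix h"
    unfolding g_def using lg(1) f by (rule matrix_compose)
  moreover have "(det (matrix h))\<^sup>2 = 1"
    using h(1) det_orthogonal_matrix[of "matrix h"] by (auto simp: orthogonal_transformation_matrix)
  ultimately show ?thesis
    by (simp add: det_mul power_mult_distrib)
qed

lemma coord_proj_eq: "coord_proj j x = x - (x $ j) *\<^sub>R axis j 1"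
  by (vector coord_proj_def axis_def)

lemma linear_coord_proj: "linear (coord_proj j)"
  by (rule linearI) (vector coord_proj_def; simp)+

lemma inner_coord_proj: "coord_proj j x \<bullet> coord_proj j y = x \<bullet> y - x $ j * y $ j"
  by (simp add: coord_proj_eq inner_diff_left inner_diff_right inner_axis inner_axis')

text \<open>Orthonormal coordinates on a hyperplane: \<open>J\<close> and its inverse
  \<open>g\<close> transport Lebesgue measure results on \<open>real ^ 'd\<close> to the hyperplane
  orthogonal to \<open>\<nu>\<close>.\<close>

lemma hyperplane_isometry:
  fixes \<nu> :: "real ^ 'n"
  assumes "\<nu> \<noteq> 0" "CARD('n) = Suc CARD('d::finite)"
  obtains J :: "real ^ 'd \<Rightarrow> real ^ 'n" and g where
    "linear J" "linear g" "\<And>x. norm (J x) = norm x" "\<And>x. \<nu> \<bullet> J x = 0"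
    "\<And>x. g (J x) = x" "\<And>x. \<nu> \<bullet> x = 0 \<Longrightarrow> J (g x) = x" "\<And>x. \<nu> \<bullet> x = 0 \<Longrightarrow> norm (g x) = norm x"
proof (rule isometries_subspaces[of "UNIV :: (real ^ 'd) set" "{x. \<nu> \<bullet> x = 0}"])
  show "subspace {x. \<nu> \<bullet> x = 0}"
    by (rule subspace_hyperplane)
  show "dim (UNIV :: (real ^ 'd) set) = dim {x. \<nu> \<bullet> x = 0}"
    using assms by (simp add: dim_hyperplane)
  fix J :: "real ^ 'd \<Rightarrow> real ^ 'n" and g
  assume *: "linear J" "linear g" "range J = {x. \<nu> \<bullet> x = 0}" "g ` {x. \<nu> \<bullet> x = 0} = UNIV"
    "\<And>x. x \<in> UNIV \<Longrightarrow> norm (J x) = norm x" "\<And>x. x \<in> {x. \<nu> \<bullet> x = 0} \<Longrightarrow> norm (g x) = norm x"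
    "\<And>x. x \<in> UNIV \<Longrightarrow> g (J x) = x" "\<And>x. x \<in> {x. \<nu> \<bullet> x = 0} \<Longrightarrow> J (g x) = x"
  show thesis
    by (rule that[of J g]) (use * in auto)
qed auto

lemma hausdorff_measure_linear_isometry:
  assumes "linear f" "\<And>x. norm (f x) = norm x" "s > 0"
  shows "hausdorff_measure s (f ` A) = hausdorff_measure s A"
  using hausdorff_measure_isometric[of s A f id] assms
  by (simp add: dist_norm flip: linear_diff[OF assms(1)])

text \<open>In orthonormal coordinates of the two hyperplanes the projection becomes a square matrix
  whose determinant has absolute value \<open>\<bar>\<nu> $ j\<bar>\<close>; Lebesgue measure is
  multiplied by this factor.\<close>

lemma hausdorff_measure_coord_proj_hyperplane:
  fixes \<nu> :: "real ^ 'n" and J :: "real ^ 'd::{finite,wellorder} \<Rightarrow> real ^ 'n"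
  assumes \<nu>: "norm \<nu> = 1" and card: "CARD('n) = Suc CARD('d)"
    and J: "linear J" "\<And>x. norm (J x) = norm x" "\<And>x. \<nu> \<bullet> J x = 0" "\<And>x. \<nu> \<bullet> x = 0 \<Longrightarrow> J (g x) = x"
    and X: "X \<in> lmeasurable" "bounded X"
  shows "hausdorff_measure (real CARD('d)) (coord_proj j ` J ` X)
      = ennreal \<bar>\<nu> $ j\<bar> * hausdorff_measure (real CARD('d)) (J ` X)"
proof -
  let ?H = "\<lambda>A::(real, 'd) vec set. hausdorff_measure (real CARD('d)) A"
  let ?H' = "\<lambda>A::(real ^ 'n) set. hausdorff_measure (real CARD('d)) A"
  let ?C = "hausdorff_cube_const TYPE((real, 'd) vec)"
  have "axis j 1 \<noteq> (0 :: real ^ 'n)"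
    by (simp add: axis_eq_0_iff)
  then obtain I :: "(real, 'd) vec \<Rightarrow> real ^ 'n" and h where I: "linear I" "linear h" "\<And>x. norm (I x) = norm x"
    "\<And>x. axis j 1 \<bullet> x = 0 \<Longrightarrow> I (h x) = x"
    using hyperplane_isometry[OF _ card] by metis
  have IhP: "I (h (coord_proj j x)) = coord_proj j x" for x
    by (rule I(4)) (simp add: inner_axis' coord_proj_def)
  define M where "M = h \<circ> coord_proj j \<circ> J"
  have M: "linear M"
    unfolding M_def by (intro linear_compose I J linear_coord_proj)
  \<comment> \<open>The coordinates of the tangential part of the \<open>j\<close>-th unit vector,
    so that \<open>J x $ j = w \<bullet> x\<close>.\<close>
  define w where "w = g (axis j 1 - (\<nu> $ j) *\<^sub>R \<nu>)"
  have Jw: "J w = axis j 1 - (\<nu> $ j) *\<^sub>R \<nu>"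
    unfolding w_def using \<nu>
    by (intro J(4)) (simp add: inner_diff_right inner_axis norm_eq_1)
  have wx: "J x $ j = w \<bullet> x" for x
  proof -
    have "w \<bullet> x = J w \<bullet> J x"
      by (simp add: linear_isometry_inner J)
    also have "\<dots> = J x $ j"
      by (simp add: Jw inner_diff_left J inner_axis')
    finally show ?thesis by simp
  qed
  have "w \<bullet> w = J w \<bullet> J w"
    by (simp add: linear_isometry_inner J)
  also have "\<dots> = 1 - (\<nu> $ j)\<^sup>2"
    using \<nu> by (simp add: Jw inner_diff_left inner_diff_right inner_axis inner_axis' norm_eq_1 power2_eq_square)
  finally have ww: "w \<bullet> w = 1 - (\<nu> $ j)\<^sup>2" .
  have "M x \<bullet> M y = x \<bullet> y - (w \<bullet> x) * (w \<bullet> y)" for x y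
  proof -
    have "M x \<bullet> M y = I (M x) \<bullet> I (M y)"
      by (simp add: linear_isometry_inner I)
    also have "\<dots> = coord_proj j (J x) \<bullet> coord_proj j (J y)"
      by (simp add: M_def IhP)
    also have "\<dots> = x \<bullet> y - (w \<bullet> x) * (w \<bullet> y)"
      by (simp add: inner_coord_proj wx linear_isometry_inner J)
    finally show ?thesis .
  qed
  from det_sq_of_inner_defect[OF M this] have "(det (matrix M))\<^sup>2 = (\<nu> $ j)\<^sup>2"
    by (simp add: ww)
  then have det: "\<bar>det (matrix M)\<bar> = \<bar>\<nu> $ j\<bar>"
    by (metis real_sqrt_abs)
  have bM: "bounded (M ` X)"
    using X(2) M by (simp add: bounded_linear_image linear_conv_bounded_linear)
  have "coord_proj j ` J ` X = I ` M ` X"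
    by (simp add: image_image M_def IhP)
  then have "?H' (coord_proj j ` J ` X) = ?H (M ` X)"
    by (simp add: hausdorff_measure_linear_isometry I)
  also have "\<dots> = ennreal (?C * (\<bar>\<nu> $ j\<bar> * measure lebesgue X))"
    using hausdorff_measure_eq_lebesgue[of "M ` X"] measurable_linear_image[OF M X(1)] bM
      measure_linear_image[OF M X(1)] by (simp add: det)
  also have "\<dots> = ennreal \<bar>\<nu> $ j\<bar> * ?H X"
    using hausdorff_measure_eq_lebesgue[OF X] by (simp add: ennreal_mult[symmetric] mult.left_commute)
  also have "?H X = ?H' (J ` X)"
    by (simp add: hausdorff_measure_linear_isometry J)
  finally show ?thesis .
qed

section \<open>Hypersurfaces and antichains\<close>

text \<open>\<open>\<nu>\<close> is the normalised gradient at \<open>p\<close>, fixed before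
  \<open>e\<close>. By the mean value theorem a chord of \<open>S\<close> is orthogonal to the
  gradient at some point near \<open>p\<close>, which by continuity is close to the gradient at
  \<open>p\<close>.\<close>

lemma hypersurface_almost_flat:
  fixes S :: "(real ^ 'n) set"
  assumes "smooth_hypersurface S" "p \<in> S"
  shows "\<exists>\<nu>. norm \<nu> = 1 \<and> (\<forall>e>0. \<exists>r>0. compact (S \<inter> cball p r) \<and>
    (\<forall>x \<in> S \<inter> cball p r. \<forall>y \<in> S \<inter> cball p r. \<bar>\<nu> \<bullet> (x - y)\<bar> \<le> e * norm (x - y)))"
proof -
  have "\<exists>U f g. open U \<and> p \<in> U \<and> smooth_fun_on U f \<and> (\<forall>x\<in>U. GDERIV f x :> g x) \<and>
      (\<forall>x\<in>S \<inter> U. g x \<noteq> 0) \<and> S \<inter> U = {x \<in> U. f x = 0}"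
    using assms(1)[unfolded smooth_hypersurface_def] assms(2) by (rule bspec)
  then obtain U f g' where *: "open U \<and> p \<in> U \<and> smooth_fun_on U f \<and> (\<forall>x\<in>U. GDERIV f x :> g' x) \<and>
      (\<forall>x\<in>S \<inter> U. g' x \<noteq> 0) \<and> S \<inter> U = {x \<in> U. f x = 0}"
    by (elim exE) (rule that)
  then have U: "open U" "p \<in> U" "smooth_fun_on U f"
    "\<And>x. x \<in> U \<Longrightarrow> GDERIV f x :> g' x" "\<And>x. x \<in> S \<inter> U \<Longrightarrow> g' x \<noteq> 0" "S \<inter> U = {x \<in> U. f x = 0}"
    by simp_all
  have "Ck_on (Suc 0) U f"
    using U(3) unfolding smooth_fun_on_def by blast
  then obtain g where g: "\<And>x. x \<in> U \<Longrightarrow> GDERIV f x :> g x" "\<And>i. continuous_on U (\<lambda>x. g x $ i)"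
    by auto
  \<comment> \<open>The continuous gradient \<open>g\<close> from the C^1 property and the
    nonvanishing gradient \<open>g'\<close> come from separate existentials; uniqueness of the
    derivative identifies them at \<open>p\<close>.\<close>
  have "(\<lambda>h. h \<bullet> g p) = (\<lambda>h. h \<bullet> g' p)"
    using g(1)[OF U(2)] U(4)[OF U(2)] unfolding gderiv_def by (rule has_derivative_unique)
  then have "g p = g' p"
    by (metis vector_eq_ldot)
  then have gp: "norm (g p) > 0"
    using U(5) U(2) assms(2) by simp
  have "continuous_on U (\<lambda>x. \<chi> i. g x $ i)"
    using g(2) by (rule continuous_on_vec_lambda)
  then have cont: "isCont g p"
    using U(1,2) by (simp add: continuous_on_eq_continuous_at)
  define \<nu> where "\<nu> = g p /\<^sub>R norm (g p)"
  have "norm \<nu> = 1"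
    using gp by (simp add: \<nu>_def)
  moreover have "\<exists>r>0. compact (S \<inter> cball p r) \<and>
    (\<forall>x \<in> S \<inter> cball p r. \<forall>y \<in> S \<inter> cball p r. \<bar>\<nu> \<bullet> (x - y)\<bar> \<le> e * norm (x - y))" if "e > 0" for e
  proof -
    obtain r1 where r1: "r1 > 0" "\<And>x. dist x p < r1 \<Longrightarrow> dist (g x) (g p) < e * norm (g p)"
      using cont gp \<open>e > 0\<close> unfolding continuous_at_eps_delta by (metis mult_pos_pos)
    obtain r2 where r2: "r2 > 0" "cball p r2 \<subseteq> U"
      using U(1,2) open_contains_cball by blast
    define r where "r = min (r1 / 2) r2"
    have r: "r > 0" "cball p r \<subseteq> U" "\<And>x. x \<in> cball p r \<Longrightarrow> norm (g x - g p) \<le> e * norm (g p)"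
    proof -
      show "r > 0" using r1 r2 by (simp add: r_def)
      show "cball p r \<subseteq> U" using r2(2) by (auto simp: r_def)
      fix x assume "x \<in> cball p r"
      then have "dist x p < r1"
        using r1(1) by (simp add: r_def dist_commute)
      then show "norm (g x - g p) \<le> e * norm (g p)"
        using r1(2) by (simp add: dist_norm less_imp_le)
    qed
    have "S \<inter> cball p r = {x \<in> cball p r. f x = 0}"
      using U(6) r(2) by blast
    moreover have "continuous_on (cball p r) f"
      using r(2) g(1) has_derivative_continuous unfolding gderiv_def
      by (intro continuous_at_imp_continuous_on) blast
    then have "closed {x \<in> cball p r. f x = 0}"
      by (rule continuous_closed_preimage_constant) simp
    ultimately have "compact (S \<inter> cball p r)"
      by (metis bounded_Int bounded_cball compact_eq_bounded_closed)
    moreover have "\<bar>\<nu> \<bullet> (x - y)\<bar> \<le> e * norm (x - y)"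
      if x: "x \<in> S \<inter> cball p r" and y: "y \<in> S \<inter> cball p r" for x y
    proof -
      \<comment> \<open>\<open>f\<close> vanishes at \<open>x\<close> and \<open>y\<close>, so its gradient is orthogonal to \<open>x - y\<close> somewhere in between.\<close>
      define c where "c t = y + t *\<^sub>R (x - y)" for t :: real
      have c: "c t \<in> cball p r" if "0 \<le> t" "t \<le> 1" for t
      proof -
        have "c t = (1 - t) *\<^sub>R y + t *\<^sub>R x"
          by (simp add: c_def algebra_simps)
        then show ?thesis
          using x y that convex_cball[of p r] by (simp add: convex_alt)
      qed
      have "((\<lambda>t. f (c t)) has_field_derivative (x - y) \<bullet> g (c t)) (at t)" if "0 \<le> t" "t \<le> 1" for t
      proof -
        have "(f has_derivative (\<lambda>h. h \<bullet> g (c t))) (at (c t))"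
          using g(1) r(2) c[OF that] unfolding gderiv_def by blast
        moreover have "(c has_derivative (\<lambda>h. h *\<^sub>R (x - y))) (at t)"
          unfolding c_def by (auto intro!: derivative_eq_intros)
        ultimately have "((\<lambda>t. f (c t)) has_derivative (\<lambda>h. (h *\<^sub>R (x - y)) \<bullet> g (c t))) (at t)"
          by (rule has_derivative_compose[rotated])
        then show ?thesis
          by (simp add: has_field_derivative_def mult_commute_abs)
      qed
      from MVT2[OF zero_less_one this] obtain t where t: "0 < t" "t < 1"
        "f (c 1) - f (c 0) = (1 - 0) * ((x - y) \<bullet> g (c t))"
        by blast
      have "f x = 0" "f y = 0"
        using x y U(6) r(2) by blast+
      then have "(x - y) \<bullet> g (c t) = 0"
        using t(3) by (simp add: c_def)
      then have "\<bar>(x - y) \<bullet> g p\<bar> = \<bar>(x - y) \<bullet> (g (c t) - g p)\<bar>"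
        by (simp add: inner_diff_right)
      also have "\<dots> \<le> norm (x - y) * norm (g (c t) - g p)"
        by (rule Cauchy_Schwarz_ineq2)
      also have "\<dots> \<le> norm (x - y) * (e * norm (g p))"
        using r(3) c[of t] t by (intro mult_left_mono) auto
      finally have "\<bar>(x - y) \<bullet> g p\<bar> / norm (g p) \<le> e * norm (x - y)"
        using gp by (simp add: pos_divide_le_eq algebra_simps)
      then show ?thesis
        by (simp add: \<nu>_def inner_commute abs_mult divide_inverse mult.commute)
    qed
    ultimately show ?thesis using r(1) by blast
  qed
  ultimately show ?thesis by blast
qed

section \<open>Distortion of distances near a tangent hyperplane\<close>

lemma norm_coord_proj_le: "norm (coord_proj j x) \<le> norm x"
  unfolding norm_le inner_coord_proj by simp

text \<open>Cauchy-Schwarz with the tangential part \<open>u\<close> of the \<open>j\<close>-th unit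
  vector bounds \<open>(q $ j)\<^sup>2\<close> by
  \<open>(1 - (\<nu> $ j)\<^sup>2) * (q \<bullet> q)\<close>.\<close>

lemma norm_coord_proj_hyperplane_ge:
  assumes "norm \<nu> = 1" "\<nu> \<bullet> q = 0"
  shows "\<bar>\<nu> $ j\<bar> * norm q \<le> norm (coord_proj j q)"
proof -
  define u where "u = axis j 1 - (\<nu> $ j) *\<^sub>R \<nu>"
  have "q $ j = u \<bullet> q"
    using assms by (simp add: u_def inner_diff_left inner_axis')
  then have "(q $ j)\<^sup>2 \<le> (u \<bullet> u) * (q \<bullet> q)"
    by (simp add: Cauchy_Schwarz_ineq)
  also have "u \<bullet> u = 1 - (\<nu> $ j)\<^sup>2"
    using assms by (simp add: u_def inner_diff_left inner_diff_right inner_axis inner_axis' norm_eq_1 power2_eq_square)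
  finally have "(\<bar>\<nu> $ j\<bar> * norm q)\<^sup>2 \<le> (norm (coord_proj j q))\<^sup>2"
    unfolding power_mult_distrib power2_norm_eq_inner inner_coord_proj
    by (simp add: power2_eq_square algebra_simps)
  then show ?thesis
    by (rule power2_le_imp_le) simp
qed

text \<open>Let \<open>q\<close> be the orthogonal projection of \<open>z\<close> to the hyperplane.
  Then \<open>z - q\<close> has norm at most \<open>e * norm z\<close>. This gives the first bound;
  for the second, the error is absorbed because \<open>norm z\<close> is at most a constant times
  \<open>norm (coord_proj j q)\<close> when \<open>\<nu> $ j \<noteq> 0\<close>.\<close>

lemma near_hyperplane_projection_bounds:
  fixes \<nu> :: "real ^ 'n"
  assumes \<nu>: "norm \<nu> = 1" and L: "L > 1"
  shows "\<exists>e>0. \<forall>z. \<bar>\<nu> \<bullet> z\<bar> \<le> e * norm z \<longrightarrow>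
    norm z \<le> L * norm (z - (\<nu> \<bullet> z) *\<^sub>R \<nu>) \<and>
    (\<forall>j. \<nu> $ j \<noteq> 0 \<longrightarrow> norm (coord_proj j (z - (\<nu> \<bullet> z) *\<^sub>R \<nu>)) \<le> L * norm (coord_proj j z))"
proof -
  \<comment> \<open>All conditions on \<open>e\<close> hold for small \<open>e\<close>, as the right
    sides tend to \<open>L > 1\<close>; since there are finitely many \<open>j\<close>, one
    \<open>e\<close> serves them all.\<close>
  have "\<forall>\<^sub>F e in at_right 0. 1 < L * (1 - e)"
    by (rule order_tendstoD(1)[where y = L]) (auto intro!: tendsto_eq_intros simp: L)
  moreover have "\<forall>\<^sub>F e in at_right 0. \<forall>j. \<nu> $ j \<noteq> 0 \<longrightarrow> 1 < L * (1 - e / (\<bar>\<nu> $ j\<bar> * (1 - e)))"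
  proof (rule eventually_all_finite)
    fix j
    show "\<forall>\<^sub>F e in at_right 0. \<nu> $ j \<noteq> 0 \<longrightarrow> 1 < L * (1 - e / (\<bar>\<nu> $ j\<bar> * (1 - e)))"
    proof (cases "\<nu> $ j = 0")
      case False
      then have "\<forall>\<^sub>F e in at_right 0. 1 < L * (1 - e / (\<bar>\<nu> $ j\<bar> * (1 - e)))"
        by (intro order_tendstoD(1)[where y = L]) (auto intro!: tendsto_eq_intros simp: L)
      then show ?thesis by eventually_elim simp
    qed simp
  qed
  moreover have "\<forall>\<^sub>F e in at_right 0. e \<in> {0<..<1::real}"
    by (rule eventually_at_right_real) simp
  ultimately have "\<forall>\<^sub>F e in at_right 0. e \<in> {0<..<1::real} \<and> 1 < L * (1 - e) \<and>
      (\<forall>j. \<nu> $ j \<noteq> 0 \<longrightarrow> 1 < L * (1 - e / (\<bar>\<nu> $ j\<bar> * (1 - e))))"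
    by eventually_elim simp
  then have "\<exists>e. e \<in> {0<..<1::real} \<and> 1 < L * (1 - e) \<and>
      (\<forall>j. \<nu> $ j \<noteq> 0 \<longrightarrow> 1 < L * (1 - e / (\<bar>\<nu> $ j\<bar> * (1 - e))))"
    by (rule eventually_happens'[OF trivial_limit_at_right_real])
  then obtain e where e: "0 < e" "e < 1" "1 < L * (1 - e)"
      "\<And>j. \<nu> $ j \<noteq> 0 \<Longrightarrow> 1 < L * (1 - e / (\<bar>\<nu> $ j\<bar> * (1 - e)))"
    by auto
  have "norm z \<le> L * norm (z - (\<nu> \<bullet> z) *\<^sub>R \<nu>) \<and>
    (\<forall>j. \<nu> $ j \<noteq> 0 \<longrightarrow> norm (coord_proj j (z - (\<nu> \<bullet> z) *\<^sub>R \<nu>)) \<le> L * norm (coord_proj j z))"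
    if z: "\<bar>\<nu> \<bullet> z\<bar> \<le> e * norm z" for z
  proof (intro conjI allI impI)
    define q where "q = z - (\<nu> \<bullet> z) *\<^sub>R \<nu>"
    have \<nu>q: "\<nu> \<bullet> q = 0"
      using \<nu> by (simp add: q_def inner_diff_right norm_eq_1)
    have "norm z \<le> norm q + norm ((\<nu> \<bullet> z) *\<^sub>R \<nu>)"
      unfolding q_def by (metis diff_add_cancel norm_triangle_ineq)
    then have q: "(1 - e) * norm z \<le> norm q"
      using z \<nu> by (simp add: algebra_simps)
    have "1 * norm z \<le> (L * (1 - e)) * norm z"
      using e by (intro mult_right_mono) auto
    also have "\<dots> \<le> L * norm q"
      using q L by (simp add: mult.assoc)
    finally show "norm z \<le> L * norm (z - (\<nu> \<bullet> z) *\<^sub>R \<nu>)"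
      by (simp add: q_def)
    fix j assume j: "\<nu> $ j \<noteq> 0"
    define k where "k = \<bar>\<nu> $ j\<bar> * (1 - e)"
    have k: "k > 0" using j e by (simp add: k_def)
    have "k * norm z \<le> \<bar>\<nu> $ j\<bar> * norm q"
      using q by (simp add: k_def mult.assoc mult_left_mono)
    also have "\<dots> \<le> norm (coord_proj j q)"
      using norm_coord_proj_hyperplane_ge[OF \<nu> \<nu>q] .
    finally have "norm z \<le> norm (coord_proj j q) / k"
      using k by (simp add: pos_le_divide_eq mult.commute)
    then have ez: "e * norm z \<le> e / k * norm (coord_proj j q)"
      using e(1) by (simp add: mult_left_mono flip: times_divide_eq_right)
    have "coord_proj j q = coord_proj j z - (\<nu> \<bullet> z) *\<^sub>R coord_proj j \<nu>"
      by (simp add: q_def linear_diff[OF linear_coord_proj] linear_cmul[OF linear_coord_proj])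
    then have "norm (coord_proj j q) \<le> norm (coord_proj j z) + \<bar>\<nu> \<bullet> z\<bar> * norm (coord_proj j \<nu>)"
      by (metis norm_scaleR norm_triangle_ineq4)
    also have "\<dots> \<le> norm (coord_proj j z) + e * norm z"
      using z norm_coord_proj_le[of j \<nu>] \<nu> by (smt (verit) mult_left_le abs_ge_zero)
    finally have "(1 - e / k) * norm (coord_proj j q) \<le> norm (coord_proj j z)"
      using ez by (simp add: algebra_simps)
    then have "L * ((1 - e / k) * norm (coord_proj j q)) \<le> L * norm (coord_proj j z)"
      using L by simp
    moreover have "1 * norm (coord_proj j q) \<le> (L * (1 - e / k)) * norm (coord_proj j q)"
      using e(4)[OF j] unfolding k_def by (intro mult_right_mono) auto
    ultimately show "norm (coord_proj j (z - (\<nu> \<bullet> z) *\<^sub>R \<nu>)) \<le> L * norm (coord_proj j z)"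
      by (simp add: q_def mult.assoc)
  qed
  with e(1) show ?thesis by blast
qed

text \<open>Pass from the piece to its image in the tangent hyperplane, from there to the coordinate
  projections of that image, and back to those of the piece; the first and last passages each cost a
  factor \<open>L powr d\<close>. The radius is chosen before \<open>K\<close> and
  \<open>K'\<close>, so that pieces can later be cut freely.\<close>

lemma hausdorff_measure_local_le_projections:
  fixes S :: "(real ^ 'n) set"
  assumes card: "CARD('n) = Suc CARD('d::{finite,wellorder})"
    and S: "smooth_hypersurface S" "p \<in> S" and L: "L > 1"
  shows "\<exists>r>0. compact (S \<inter> cball p r) \<and>
    (\<forall>K K'. compact K \<longrightarrow> compact K' \<longrightarrow> K' \<subseteq> K \<longrightarrow> K \<subseteq> S \<inter> cball p r \<longrightarrow>
      hausdorff_measure (real CARD('d)) (K - K') \<le> ennreal (L powr real CARD('d) * L powr real CARD('d)) *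
        (\<Sum>j\<in>UNIV. hausdorff_measure (real CARD('d)) (coord_proj j ` (K - K'))))"
proof -
  let ?d = "real CARD('d)"
  let ?H = "\<lambda>A::(real ^ 'n) set. hausdorff_measure ?d A"
  let ?L = "L powr ?d"
  have d: "?d > 0" by simp
  obtain \<nu> where \<nu>: "norm \<nu> = 1" and flat: "\<forall>e>0. \<exists>r>0. compact (S \<inter> cball p r) \<and>
      (\<forall>x \<in> S \<inter> cball p r. \<forall>y \<in> S \<inter> cball p r. \<bar>\<nu> \<bullet> (x - y)\<bar> \<le> e * norm (x - y))"
    using hypersurface_almost_flat[OF S] by (elim exE conjE) (rule that)
  obtain e where e: "e > 0" and bounds: "\<forall>z. \<bar>\<nu> \<bullet> z\<bar> \<le> e * norm z \<longrightarrow>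
      norm z \<le> L * norm (z - (\<nu> \<bullet> z) *\<^sub>R \<nu>) \<and>
      (\<forall>j. \<nu> $ j \<noteq> 0 \<longrightarrow> norm (coord_proj j (z - (\<nu> \<bullet> z) *\<^sub>R \<nu>)) \<le> L * norm (coord_proj j z))"
    using near_hyperplane_projection_bounds[OF \<nu> L] by (elim exE conjE) (rule that)
  obtain r where r: "r > 0" "compact (S \<inter> cball p r)"
    "\<And>x y. x \<in> S \<inter> cball p r \<Longrightarrow> y \<in> S \<inter> cball p r \<Longrightarrow> \<bar>\<nu> \<bullet> (x - y)\<bar> \<le> e * norm (x - y)"
    using flat e by (metis (no_types, lifting))
  have "\<nu> \<noteq> 0" using \<nu> by auto
  then obtain J :: "(real, 'd) vec \<Rightarrow> real ^ 'n" and g where J: "linear J" "linear g"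
    "\<And>x. norm (J x) = norm x" "\<And>x. \<nu> \<bullet> J x = 0" "\<And>x. \<nu> \<bullet> x = 0 \<Longrightarrow> J (g x) = x"
    using hyperplane_isometry[OF _ card] by metis
  define q where "q z = z - (\<nu> \<bullet> z) *\<^sub>R \<nu>" for z
  have q: "linear q"
    unfolding q_def by (rule linearI) (simp_all add: algebra_simps inner_add_right)
  have \<nu>q: "\<nu> \<bullet> q z = 0" for z
    using \<nu> by (simp add: q_def inner_diff_right norm_eq_1)
  have dist_q: "dist x y \<le> L * dist (q x) (q y)"
    and dist_pq: "\<nu> $ j \<noteq> 0 \<Longrightarrow> dist (coord_proj j (q x)) (coord_proj j (q y)) \<le> L * dist (coord_proj j x) (coord_proj j y)"
    if "x \<in> S \<inter> cball p r" "y \<in> S \<inter> cball p r" for x y j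
    using bounds[rule_format, OF r(3)[OF that]]
    by (simp_all add: dist_norm q_def[symmetric] linear_diff[OF q] flip: linear_diff[OF linear_coord_proj])
  have "?H (K - K') \<le> ennreal (?L * ?L) * (\<Sum>j\<in>UNIV. ?H (coord_proj j ` (K - K')))"
    if K: "compact K" "compact K'" "K' \<subseteq> K" "K \<subseteq> S \<inter> cball p r" for K K'
  proof -
    define A where "A = K - K'"
    have A: "A \<subseteq> S \<inter> cball p r"
      using K by (auto simp: A_def)
    define X where "X = (g \<circ> q) ` A"
    have lin: "linear (g \<circ> q)"
      using q J(2) by (rule linear_compose)
    have inj: "inj_on (g \<circ> q) K"
    proof (rule inj_onI)
      fix x y assume xy: "x \<in> K" "y \<in> K" "(g \<circ> q) x = (g \<circ> q) y"
      then have "q x = q y"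
        using J(5)[OF \<nu>q] by (metis comp_apply)
      then show "x = y"
        using dist_q[of x y] xy K by (auto simp: subset_iff)
    qed
    have "continuous_on K (g \<circ> q)"
      using lin by (simp only: linear_continuous_on linear_conv_bounded_linear)
    note X = inj_image_compact_Diff_lmeasurable[OF K(1-3) this inj, folded A_def, folded X_def]
    have JX: "J ` X = q ` A"
      by (simp add: X_def image_image J(5)[OF \<nu>q])
    have proj: "?H (coord_proj j ` q ` A) = ennreal \<bar>\<nu> $ j\<bar> * ?H (q ` A)" for j
      unfolding JX[symmetric]
      by (rule hausdorff_measure_coord_proj_hyperplane[OF \<nu> card J(1,3,4) _ X]) (rule J(5))
    have "?H A \<le> ennreal ?L * ?H (q ` A)"
      using hausdorff_measure_Lipschitz[of L ?d A id q] dist_q A L d by (auto simp: subset_iff)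
    also have "?H (q ` A) \<le> (\<Sum>j\<in>UNIV. ?H (coord_proj j ` q ` A))"
    proof -
      \<comment> \<open>The 1-norm of the unit normal is at least its Euclidean norm.\<close>
      have "1 \<le> (\<Sum>j\<in>UNIV. \<bar>\<nu> $ j\<bar>)"
        using norm_le_l1_cart[of \<nu>] \<nu> by simp
      then have "ennreal 1 * ?H (q ` A) \<le> ennreal (\<Sum>j\<in>UNIV. \<bar>\<nu> $ j\<bar>) * ?H (q ` A)"
        by (intro mult_right_mono ennreal_leI) auto
      also have "\<dots> = (\<Sum>j\<in>UNIV. ennreal \<bar>\<nu> $ j\<bar> * ?H (q ` A))"
        by (simp add: sum_distrib_right flip: sum_ennreal)
      also have "\<dots> = (\<Sum>j\<in>UNIV. ?H (coord_proj j ` q ` A))"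
        by (simp add: proj)
      finally show ?thesis by simp
    qed
    also have "(\<Sum>j\<in>UNIV. ?H (coord_proj j ` q ` A)) \<le> (\<Sum>j\<in>UNIV. ennreal ?L * ?H (coord_proj j ` A))"
    proof (rule sum_mono)
      fix j
      show "?H (coord_proj j ` q ` A) \<le> ennreal ?L * ?H (coord_proj j ` A)"
      proof (cases "\<nu> $ j = 0")
        \<comment> \<open>The hyperplane contains the \<open>j\<close>-th direction, so its
          projection is null and no distance comparison is called for.\<close>
        case True
        then have "?H (coord_proj j ` q ` A) = 0"
          by (simp add: proj)
        then show ?thesis by simp
      next
        case False
        then show ?thesis
          using hausdorff_measure_Lipschitz[of L ?d A "\<lambda>x. coord_proj j (q x)" "coord_proj j"] dist_pq A L d
          by (auto simp: subset_iff image_image)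
      qed
    qed
    also have "ennreal ?L * (\<Sum>j\<in>UNIV. ennreal ?L * ?H (coord_proj j ` A))
        = ennreal (?L * ?L) * (\<Sum>j\<in>UNIV. ?H (coord_proj j ` A))"
      by (simp add: ennreal_mult mult.assoc flip: sum_distrib_left)
    finally show ?thesis
      by (simp add: A_def mult_left_mono)
  qed
  with r(1,2) show ?thesis by blast
qed

text \<open>Two points with the same projection differ at most in coordinate \<open>j\<close>, hence
  are comparable.\<close>

lemma inj_on_coord_proj_antichain:
  assumes "cube_antichain S"
  shows "inj_on (coord_proj j) S"
proof (rule inj_onI)
  fix x y assume xy: "x \<in> S" "y \<in> S" "coord_proj j x = coord_proj j y"
  have eq: "x $ i = y $ i" if "i \<noteq> j" for i
    using arg_cong[OF xy(3), of "\<lambda>z. z $ i"] that by (simp add: coord_proj_def)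
  have "(\<forall>i. x $ i \<le> y $ i) \<or> (\<forall>i. y $ i \<le> x $ i)"
    by (metis eq linear)
  then show "x = y"
    using assms xy(1,2) unfolding cube_antichain_def by metis
qed

text \<open>Injectivity makes the projected pieces disjoint. The map \<open>f\<close> identifies
  their hyperplane isometrically with \<open>real ^ 'd\<close>, where measurable sets have additive
  Hausdorff measure.\<close>

lemma hausdorff_measure_coord_proj_suminf_le:
  fixes K K' :: "nat \<Rightarrow> (real ^ 'n) set"
  assumes card: "CARD('n) = Suc CARD('d::finite)"
    and K: "\<And>i. compact (K i)" "\<And>i. compact (K' i)" "\<And>i. K' i \<subseteq> K i"
    and disj: "disjoint_family (\<lambda>i. K i - K' i)" and inj: "inj_on (coord_proj j) (\<Union>i. K i)"
    and bdd: "bounded (\<Union>i. K i)"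
  shows "(\<Sum>i. hausdorff_measure (real CARD('d)) (coord_proj j ` (K i - K' i)))
    \<le> hausdorff_measure (real CARD('d)) (coord_proj j ` (\<Union>i. K i))"
proof -
  have "axis j 1 \<noteq> (0 :: real ^ 'n)"
    by (simp add: axis_eq_0_iff)
  then obtain h :: "real ^ 'n \<Rightarrow> (real, 'd) vec" where I: "linear h"
    "\<And>x. axis j 1 \<bullet> x = 0 \<Longrightarrow> norm (h x) = norm x"
    using hyperplane_isometry[OF _ card] by metis
  define f where "f = h \<circ> coord_proj j"
  have f: "linear f"
    unfolding f_def by (intro linear_compose linear_coord_proj I(1))
  have df: "dist (f x) (f y) = dist (coord_proj j x) (coord_proj j y)" for x y
  proof -
    have "norm (h (coord_proj j (x - y))) = norm (coord_proj j (x - y))"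
      by (rule I(2)) (simp add: inner_axis' coord_proj_def)
    then show ?thesis
      by (simp add: f_def dist_norm linear_diff[OF I(1)] linear_diff[OF linear_coord_proj])
  qed
  have H: "hausdorff_measure (real CARD('d)) (coord_proj j ` A) = hausdorff_measure (real CARD('d)) (f ` A)" for A
    by (rule hausdorff_measure_isometric) (simp_all add: df)
  have inj_f: "inj_on f (\<Union>i. K i)"
    using inj df by (metis (no_types, lifting) dist_eq_0_iff inj_on_def)
  define A where "A i = f ` (K i - K' i)" for i
  have "(\<Sum>i. hausdorff_measure (real CARD('d)) (A i)) = hausdorff_measure (real CARD('d)) (\<Union>i. A i)"
  proof -
    have "A i \<in> lmeasurable" for i
      unfolding A_def
    proof (rule inj_image_compact_Diff_lmeasurable[OF K])
      show "continuous_on (K i) f"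
        using f by (simp only: linear_continuous_on linear_conv_bounded_linear)
      show "inj_on f (K i)"
        using inj_f by (rule inj_on_subset) auto
    qed
    moreover have "disjoint_family A"
      unfolding disjoint_family_on_def A_def
    proof (intro ballI impI)
      fix m n :: nat assume "m \<noteq> n"
      then have "(K m - K' m) \<inter> (K n - K' n) = {}"
        using disj by (auto simp: disjoint_family_on_def)
      moreover have "f ` (K m - K' m) \<inter> f ` (K n - K' n) = f ` ((K m - K' m) \<inter> (K n - K' n))"
        by (rule inj_on_image_Int[OF inj_f, symmetric]) auto
      ultimately show "f ` (K m - K' m) \<inter> f ` (K n - K' n) = {}" by simp
    qed
    moreover have "bounded (\<Union>i. A i)"
    proof (rule bounded_subset)
      show "bounded (f ` (\<Union>i. K i))"
        using bdd f by (simp add: bounded_linear_image linear_conv_bounded_linear)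
    qed (auto simp: A_def)
    ultimately show ?thesis
      using hausdorff_measure_disjoint_UN[of A] by simp
  qed
  also have "\<dots> \<le> hausdorff_measure (real CARD('d)) (f ` (\<Union>i. K i))"
    by (rule hausdorff_measure_mono) (auto simp: A_def)
  finally show ?thesis
    by (simp only: H A_def)
qed

text \<open>Countably many good balls cover \<open>S\<close> by Lindelof. Making their traces on
  \<open>S\<close> disjoint and summing the local estimates gives the inequality up to a factor that
  tends to \<open>1\<close> with \<open>L\<close>.\<close>

lemma hausdorff_measure_antichain_le_projections:
  fixes S :: "(real ^ 'n) set"
  assumes card: "CARD('n) = Suc CARD('d::{finite,wellorder})"
    and S: "cube_antichain S" "smooth_hypersurface S"
  shows "hausdorff_measure (real CARD('d)) S
    \<le> (\<Sum>j\<in>UNIV. hausdorff_measure (real CARD('d)) (coord_proj j ` S))"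
    (is "_ \<le> ?R")
proof (cases "S = {}")
  case False
  let ?d = "real CARD('d)"
  let ?H = "\<lambda>A::(real ^ 'n) set. hausdorff_measure ?d A"
  have le: "?H S \<le> ennreal (L powr ?d * L powr ?d) * ?R" if "L > 1" for L
  proof -
    let ?c = "ennreal (L powr ?d * L powr ?d)"
    have "\<forall>p\<in>S. \<exists>r>0. compact (S \<inter> cball p r) \<and>
      (\<forall>K K'. compact K \<longrightarrow> compact K' \<longrightarrow> K' \<subseteq> K \<longrightarrow> K \<subseteq> S \<inter> cball p r \<longrightarrow>
        ?H (K - K') \<le> ?c * (\<Sum>j\<in>UNIV. ?H (coord_proj j ` (K - K'))))"
      using hausdorff_measure_local_le_projections[OF card S(2) _ that] by blast
    from bchoice[OF this] obtain r where *: "\<forall>p\<in>S. r p > 0 \<and> compact (S \<inter> cball p (r p)) \<and>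
      (\<forall>K K'. compact K \<longrightarrow> compact K' \<longrightarrow> K' \<subseteq> K \<longrightarrow> K \<subseteq> S \<inter> cball p (r p) \<longrightarrow>
        ?H (K - K') \<le> ?c * (\<Sum>j\<in>UNIV. ?H (coord_proj j ` (K - K'))))" ..
    note r = *[THEN bspec, THEN conjunct1] *[THEN bspec, THEN conjunct2, THEN conjunct1]
      *[THEN bspec, THEN conjunct2, THEN conjunct2, rule_format]
    have op: "open U" if "U \<in> (\<lambda>p. ball p (r p)) ` S" for U
      using that by auto
    obtain \<F> where \<F>: "\<F> \<subseteq> (\<lambda>p. ball p (r p)) ` S" "countable \<F>"
        "\<Union>\<F> = (\<Union>p\<in>S. ball p (r p))"
      by (rule Lindelof[of "(\<lambda>p. ball p (r p)) ` S"]) (rule op, assumption, rule that)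
    obtain T where T: "countable T" "T \<subseteq> S" "\<F> = (\<lambda>p. ball p (r p)) ` T"
      using \<F>(1,2) countable_subset_image[of \<F> "\<lambda>p. ball p (r p)" S] by auto
    have cover: "S \<subseteq> (\<Union>p\<in>T. ball p (r p))"
    proof
      fix x assume "x \<in> S"
      then have "x \<in> \<Union>\<F>"
        unfolding \<F>(3) using r(1) by (intro UN_I[of x]) auto
      then show "x \<in> (\<Union>p\<in>T. ball p (r p))"
        by (simp add: T(3))
    qed
    then have "T \<noteq> {}" using False by auto
    \<comment> \<open>The enumeration of \<open>T\<close> may repeat points; a repeated piece
      becomes empty once the earlier ones are removed.\<close>
    define t where "t = from_nat_into T"
    have t: "t i \<in> T" "t i \<in> S" for i
      using from_nat_into[OF \<open>T \<noteq> {}\<close>, of i] T(2) by (auto simp: t_def)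
    define K where "K i = S \<inter> cball (t i) (r (t i))" for i
    \<comment> \<open>The part of \<open>K i\<close> met earlier is a finite union of compact sets,
      so the disjointed piece is a difference of compact sets.\<close>
    define K' where "K' i = K i \<inter> (\<Union>k\<in>{0..<i}. K k)" for i
    have cK: "compact (K i)" for i
      unfolding K_def by (intro r(2) t)
    have cK': "compact (K' i)" for i
      unfolding K'_def by (intro compact_Int cK compact_UN) auto
    have dis: "K i - K' i = disjointed K i" for i
      by (auto simp: K'_def disjointed_def)
    have UK: "(\<Union>i. K i) = S"
    proof
      show "S \<subseteq> (\<Union>i. K i)"
      proof
        fix x assume "x \<in> S"
        then obtain p where p: "p \<in> T" "x \<in> ball p (r p)" using cover by blast
        then obtain i where "t i = p"
          using from_nat_into_surj[OF T(1)] unfolding t_def by metis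
        then show "x \<in> (\<Union>i. K i)"
          using p \<open>x \<in> S\<close> by (intro UN_I[of i]) (auto simp: K_def)
      qed
    qed (auto simp: K_def)
    have "bounded S"
    proof (rule bounded_subset)
      show "S \<subseteq> cbox 0 (\<chi> i. 1)"
        using S(1) by (auto simp: cube_antichain_def unit_cube_def mem_box_cart)
    qed simp
    have "?H S = ?H (\<Union>i. K i - K' i)"
      by (simp only: dis UN_disjointed_eq UK)
    also have "\<dots> \<le> (\<Sum>i. ?H (K i - K' i))"
      by (rule hausdorff_measure_countably_subadditive)
    also have "\<dots> \<le> (\<Sum>i. ?c * (\<Sum>j\<in>UNIV. ?H (coord_proj j ` (K i - K' i))))"
    proof (rule suminf_le)
      show "?H (K i - K' i) \<le> ?c * (\<Sum>j\<in>UNIV. ?H (coord_proj j ` (K i - K' i)))" for i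
        by (rule r(3)[OF t(2)[of i] cK cK']) (auto simp: K'_def K_def)
    qed auto
    also have "\<dots> = ?c * (\<Sum>j\<in>UNIV. \<Sum>i. ?H (coord_proj j ` (K i - K' i)))"
      by (simp add: suminf_sum)
    also have "\<dots> \<le> ?c * ?R"
    proof (intro mult_left_mono sum_mono)
      fix j
      show "(\<Sum>i. ?H (coord_proj j ` (K i - K' i))) \<le> ?H (coord_proj j ` S)"
        unfolding UK[symmetric]
      proof (rule hausdorff_measure_coord_proj_suminf_le[OF card cK cK'])
        show "K' i \<subseteq> K i" for i
          by (auto simp: K'_def)
        show "disjoint_family (\<lambda>i. K i - K' i)"
          unfolding dis by (rule disjoint_family_disjointed)
        show "inj_on (coord_proj j) (\<Union>i. K i)" "bounded (\<Union>i. K i)"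
          unfolding UK using S(1) \<open>bounded S\<close> by (simp_all add: inj_on_coord_proj_antichain)
      qed
    qed simp
    finally show ?thesis .
  qed
  show ?thesis
  \<comment> \<open>For finite \<open>?R\<close> let \<open>L\<close> tend to \<open>1\<close> from
    above; the infinite case is trivial.\<close>
  proof (cases ?R)
    case (real x)
    have "((\<lambda>L. ennreal (L powr ?d * L powr ?d * x)) \<longlongrightarrow> ennreal (1 powr ?d * 1 powr ?d * x)) (at_right 1)"
      by (intro tendsto_ennrealI tendsto_intros) auto
    moreover have "\<forall>\<^sub>F L in at_right 1. ?H S \<le> ennreal (L powr ?d * L powr ?d * x)"
      using eventually_at_right_less[of 1]
      by eventually_elim (use le real in \<open>simp add: ennreal_mult\<close>)
    ultimately have "?H S \<le> ennreal (1 powr ?d * 1 powr ?d * x)"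
      by (rule tendsto_lowerbound) simp
    then show ?thesis by (simp add: real)
  next
    case top
    show ?thesis unfolding top by (rule top_greatest)
  qed
qed simp

section \<open>Projections of the cube and the numerical bound\<close>

lemma hausdorff_measure_coord_proj_unit_cube_le:
  fixes S :: "(real ^ 'n) set"
  assumes card: "CARD('n) = Suc CARD('d::finite)" and S: "S \<subseteq> unit_cube"
  shows "hausdorff_measure (real CARD('d)) (coord_proj j ` S) \<le> ennreal (sigma_const CARD('d))"
proof -
  have "card (UNIV :: 'd set) = card (UNIV - {j})"
    using card by (simp add: card_Diff_singleton)
  then obtain b where b: "bij_betw b (UNIV :: 'd set) (UNIV - {j})"
    using finite_same_card_bij[of "UNIV :: 'd set" "UNIV - {j}"] by auto
  \<comment> \<open>Deleting coordinate \<open>j\<close> and relabelling the others by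
    \<open>b\<close> has the same distances as \<open>coord_proj j\<close> and lands in the unit
    cube of \<open>real ^ 'd\<close>.\<close>
  define f :: "real ^ 'n \<Rightarrow> (real, 'd) vec" where "f x = (\<chi> k. x $ b k)" for x
  have "f z \<bullet> f z = coord_proj j z \<bullet> coord_proj j z" for z
  proof -
    have "f z \<bullet> f z = (\<Sum>i\<in>UNIV - {j}. z $ i * z $ i)"
      using sum.reindex_bij_betw[OF b, of "\<lambda>i. z $ i * z $ i"] by (simp add: f_def inner_vec_def)
    also have "\<dots> = z \<bullet> z - z $ j * z $ j"
      by (simp add: inner_vec_def sum_diff1)
    finally show ?thesis by (simp add: inner_coord_proj)
  qed
  then have "dist (f x) (f y) = dist (coord_proj j x) (coord_proj j y)" for x y
  proof -
    have "f x - f y = f (x - y)"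
      by (simp add: f_def vec_eq_iff)
    then show ?thesis
      using \<open>\<And>z. f z \<bullet> f z = coord_proj j z \<bullet> coord_proj j z\<close>
      by (simp add: dist_norm norm_eq_sqrt_inner flip: linear_diff[OF linear_coord_proj])
  qed
  then have "hausdorff_measure (real CARD('d)) (coord_proj j ` S) = hausdorff_measure (real CARD('d)) (f ` S)"
    by (intro hausdorff_measure_isometric) auto
  also have "\<dots> \<le> hausdorff_measure (real CARD('d)) (cbox 0 (One :: (real, 'd) vec))"
  proof (rule hausdorff_measure_mono, safe)
    fix x assume "x \<in> S"
    then have "0 \<le> x $ i \<and> x $ i \<le> 1" for i
      using S by (auto simp: unit_cube_def)
    moreover have "(One :: (real, 'd) vec) $ k = 1" for k
      unfolding cart_eq_inner_axis by (rule inner_sum_Basis) (simp add: axis_in_Basis_iff)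
    ultimately show "f x \<in> cbox 0 One"
      by (simp add: mem_box_cart f_def)
  qed
  also have "\<dots> \<le> ennreal (sigma_const CARD('d))"
    using hausdorff_measure_unit_cube[where 'a = "(real, 'd) vec"]
      hausdorff_cube_const_le_sigma_const[where 'a = "(real, 'd) vec"]
    by (simp add: ennreal_leI)
  finally show ?thesis .
qed

text \<open>
  An index type with \<open>CARD('n) - 1\<close> elements (one element if \<open>CARD('n) < 2\<close>, as types are nonempty).
  Linear images are only available in \<open>HOL-Analysis\<close> for well-ordered index types, whence the
  order on it.
\<close>

typedef 'n hyperplane_index = "{i::nat. i < max 1 (CARD('n) - 1)}"
  by (rule exI[of _ 0]) simp

instantiation hyperplane_index :: (type) linorder
begin

definition "less_eq_hyperplane_index (i :: 'a hyperplane_index) (j :: 'a hyperplane_index) \<longleftrightarrow> Rep_hyperplane_index i \<le> Rep_hyperplane_index j"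

definition "less_hyperplane_index (i :: 'a hyperplane_index) (j :: 'a hyperplane_index) \<longleftrightarrow> Rep_hyperplane_index i < Rep_hyperplane_index j"

instance
  by standard (auto simp: less_eq_hyperplane_index_def less_hyperplane_index_def Rep_hyperplane_index_inject)

end

instance hyperplane_index :: (type) wellorder
proof
  fix P :: "'a hyperplane_index \<Rightarrow> bool" and a :: "'a hyperplane_index"
  assume step: "\<And>x. (\<And>y. y < x \<Longrightarrow> P y) \<Longrightarrow> P x"
  show "P a"
  proof (induction "Rep_hyperplane_index a" arbitrary: a rule: less_induct)
    case less
    show ?case
      by (rule step, rule less) (simp add: less_hyperplane_index_def)
  qed
qed

lemma bij_betw_Rep_hyperplane_index:
  "bij_betw Rep_hyperplane_index (UNIV :: 'n hyperplane_index set) {i. i < max 1 (CARD('n) - 1)}"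
  by (auto simp: bij_betw_def inj_on_def Rep_hyperplane_index_inject type_definition.Rep_range[OF type_definition_hyperplane_index])

instance hyperplane_index :: (type) finite
  by standard (use bij_betw_finite[OF bij_betw_Rep_hyperplane_index] in simp)

text \<open>Under this hypothesis the \<open>max 1\<close> in the type definition has no
  effect.\<close>

lemma CARD_hyperplane_index: "CARD('n) \<ge> 2 \<Longrightarrow> CARD('n) = Suc CARD('n hyperplane_index)"
  using bij_betw_same_card[OF bij_betw_Rep_hyperplane_index[where 'n = 'n]] by simp

theorem theorem1p8:
  fixes S :: "(real ^ 'n) set"
  assumes "CARD('n) \<ge> 2"
    and "cube_antichain S"
    and "smooth_hypersurface S"
  shows "hausdorff_measure (real (CARD('n) - 1)) S
           \<le> (\<Sum>j\<in>(UNIV :: 'n set). hausdorff_measure (real (CARD('n) - 1)) (coord_proj j ` S))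
       \<and> hausdorff_measure (real (CARD('n) - 1)) S
           \<le> ennreal (real CARD('n) * sigma_const (CARD('n) - 1))"
proof -
  have card: "CARD('n) = Suc CARD('n hyperplane_index)"
    using assms(1) by (rule CARD_hyperplane_index)
  then have d: "CARD('n) - 1 = CARD('n hyperplane_index)"
    by simp
  let ?d = "CARD('n) - 1"
  have 1: "hausdorff_measure (real ?d) S \<le> (\<Sum>j\<in>UNIV. hausdorff_measure (real ?d) (coord_proj j ` S))"
    unfolding d using card assms(2,3) by (rule hausdorff_measure_antichain_le_projections)
  \<comment> \<open>Each projection lies in a face of the cube and so contributes at most one
    \<open>sigma_const\<close>.\<close>
  also have "\<dots> \<le> (\<Sum>j\<in>(UNIV :: 'n set). ennreal (sigma_const ?d))"
    unfolding d using assms(2)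
    by (intro sum_mono hausdorff_measure_coord_proj_unit_cube_le card) (simp add: cube_antichain_def)
  also have "\<dots> = ennreal (real CARD('n) * sigma_const ?d)"
    by (simp add: ennreal_mult' ennreal_of_nat_eq_real_of_nat)
  finally show ?thesis using 1 by simp
qed

end
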